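(* The intervals $[\mathsf{V}(S_7),\mathsf{V}(S_7^0)]$ and $[\mathsf{V}(B_2^1),\mathsf{V}((B_2^1)^0)]$ of ai-semiring varieties both have cardinality $2^{\aleph_0}$.
   Context: An ai-semiring is an algebra $(S,+,\cdot)$ with two binary operations (no constants in the signature) such that $(S,+)$ is a commutative idempotent semigroup, $(S,\cdot)$ is a semigroup, and $x(y+z)\approx xy+xz$, $(x+y)z\approx xz+yz$ hold. $\mathsf{V}(S)$ is the variety of ai-semirings generated by $S$. For ai-semiring varieties $\mathcal{A}\subseteq\mathcal{B}$, $[\mathcal{A},\mathcal{B}]$ is the class of all varieties $\mathcal{C}$ with $\mathcal{A}\subseteq\mathcal{C}\subseteq\mathcal{B}$. For an ai-semiring $S$, $S^0=S\cup\{0\}$ is the ai-semiring obtained by adjoining a new element $0$ with $s+0=0+s=s$ and $s0=0s=0$ for all $s\in S\cup\{0\}$, the operations on $S$ being preserved. (If $S$ already has an element called $0$, the adjoined one is a different new element.) $S_7$ is the 3-element ai-semiring $\{0,a,1\}$ with $x+x=x$, $x+y=0$ for $x\neq y$, and commutative multiplication in which $1$ is an identity element, $0$ is a zero element, and $a\cdot a=0$. $B_2^1$ is the 6-element ai-semiring $\{0,1,a,b,ab,ba\}$ of $2\times 2$ matrices under matrix multiplication, where $0$ is the zero matrix, $1$ the identity matrix, $a=\begin{bmatrix}0&1\\0&0\end{bmatrix}$, $b=\begin{bmatrix}0&0\\1&0\end{bmatrix}$, $ab=\begin{bmatrix}1&0\\0&0\end{bmatrix}$, $ba=\begin{bmatrix}0&0\\0&1\end{bmatrix}$;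 its addition is the join operation of the partial order whose covering relations are $1<ab$, $1<ba$, $ab<0$, $ba<0$, $a<0$, $b<0$. *)

theory Defs
  imports "HOL-Analysis.Analysis" "HOL-Library.Equipollence"
begin

section \<open>Ai-semirings\<close>

record 'a alg =
  carrier :: "'a set"
  add :: "'a \<Rightarrow> 'a \<Rightarrow> 'a"
  mul :: "'a \<Rightarrow> 'a \<Rightarrow> 'a"

definition ai_semiring :: "'a alg \<Rightarrow> bool" where
  "ai_semiring A \<longleftrightarrow>
     carrier A \<noteq> {} \<and>
     (\<forall>x\<in>carrier A. \<forall>y\<in>carrier A. add A x y \<in> carrier A \<and> mul A x y \<in> carrier A) \<and>
     (\<forall>x\<in>carrier A. add A x x = x) \<and>
     (\<forall>x\<in>carrier A. \<forall>y\<in>carrier A. add A x y = add A y x) \<and>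
     (\<forall>x\<in>carrier A. \<forall>y\<in>carrier A. \<forall>z\<in>carrier A.
        add A (add A x y) z = add A x (add A y z) \<and>
        mul A (mul A x y) z = mul A x (mul A y z) \<and>
        mul A x (add A y z) = add A (mul A x y) (mul A x z) \<and>
        mul A (add A x y) z = add A (mul A x z) (mul A y z))"

definition is_hom :: "('a \<Rightarrow> 'b) \<Rightarrow> 'a alg \<Rightarrow> 'b alg \<Rightarrow> bool" where
  "is_hom h A B \<longleftrightarrow>
     h ` carrier A \<subseteq> carrier B \<and>
     (\<forall>x\<in>carrier A. \<forall>y\<in>carrier A.
        h (add A x y) = add B (h x) (h y) \<and> h (mul A x y) = mul B (h x) (h y))"

definition isomorphic :: "'a alg \<Rightarrow> 'b alg \<Rightarrow> bool" where
  "isomorphic A B \<longleftrightarrow> (\<exists>h. is_hom h A B \<and> bij_betw h (carrier A) (carrier B))"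

definition subuniverse :: "'a set \<Rightarrow> 'a alg \<Rightarrow> bool" where
  "subuniverse B A \<longleftrightarrow>
     B \<noteq> {} \<and> B \<subseteq> carrier A \<and> (\<forall>x\<in>B. \<forall>y\<in>B. add A x y \<in> B \<and> mul A x y \<in> B)"

definition prod_alg :: "'i set \<Rightarrow> ('i \<Rightarrow> 'a alg) \<Rightarrow> ('i \<Rightarrow> 'a) alg" where
  "prod_alg I F = \<lparr>
     carrier = (\<Pi>\<^sub>E i\<in>I. carrier (F i)),
     add = (\<lambda>f g. \<lambda>i\<in>I. add (F i) (f i) (g i)),
     mul = (\<lambda>f g. \<lambda>i\<in>I. mul (F i) (f i) (g i))\<rparr>"

text \<open>\<open>A\<close> is a homomorphic image of a subalgebra of the direct product of the family \<open>F\<close>.\<close>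

definition hsp_image :: "'i set \<Rightarrow> ('i \<Rightarrow> 'a alg) \<Rightarrow> 'b alg \<Rightarrow> bool" where
  "hsp_image I F A \<longleftrightarrow>
     (\<exists>B h. subuniverse B (prod_alg I F) \<and>
        is_hom h (prod_alg I F\<lparr>carrier := B\<rparr>) A \<and> h ` B = carrier A)"


section \<open>Varieties\<close>

text \<open>
  HOL has no classes of algebras ranging over all types. A variety is therefore rendered by its
  members whose carrier is a subset of an arbitrary but fixed infinite type \<open>'u\<close>. As a variety is
  determined by its countable members, nothing is lost: different varieties have different traces
  on \<open>'u\<close>, and inclusions between varieties can be tested on these traces.

  A direct product of members usually lives in a larger type, so closure under homomorphic
  images, subalgebras and direct products is required in one step. Index sets inside \<open>'u\<close> are
  enough: by \<open>ai_variety_hsp\<close> below, closure under products with arbitrary index sets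
  follows, and by \<open>birkhoff\<close> the traces in question are exactly the equational classes.
\<close>

definition ai_variety :: "'u alg set \<Rightarrow> bool" where
  "ai_variety K \<longleftrightarrow>
     K \<subseteq> {A. ai_semiring A} \<and>
     (\<forall>(I :: 'u set) F A. (\<forall>i\<in>I. F i \<in> K) \<and> hsp_image I F A \<longrightarrow> A \<in> K)"

text \<open>
  The least variety containing \<open>S\<close>. The algebra \<open>S\<close> has its own type, hence it is represented
  by an isomorphic copy inside \<open>'u\<close>, which exists whenever \<open>S\<close> is finite and \<open>'u\<close> is infinite; see \<open>generated_variety_eq\<close>.
\<close>

definition generated_variety :: "'s alg \<Rightarrow> 'u alg set" where
  "generated_variety S = \<Inter>{K. ai_variety K \<and> (\<exists>A\<in>K. isomorphic S A)}"

definition variety_interval :: "'u alg set \<Rightarrow> 'u alg set \<Rightarrow> 'u alg set set" where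
  "variety_interval K L = {M. ai_variety M \<and> K \<subseteq> M \<and> M \<subseteq> L}"


section \<open>The ai-semirings in question\<close>

definition adjoin_zero :: "'a alg \<Rightarrow> 'a option alg" where
  "adjoin_zero S = \<lparr>
     carrier = insert None (Some ` carrier S),
     add = (\<lambda>x y. case x of None \<Rightarrow> y
       | Some s \<Rightarrow> (case y of None \<Rightarrow> x | Some t \<Rightarrow> Some (add S s t))),
     mul = (\<lambda>x y. case x of None \<Rightarrow> None
       | Some s \<Rightarrow> (case y of None \<Rightarrow> None | Some t \<Rightarrow> Some (mul S s t)))\<rparr>"

datatype s7 = S7_0 | S7_a | S7_1

definition S7 :: "s7 alg" where
  "S7 = \<lparr>
     carrier = UNIV,
     add = (\<lambda>x y. if x = y then x else S7_0),
     mul = (\<lambda>x y. if x = S7_1 then y else if y = S7_1 then x else S7_0)\<rparr>"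

definition mat_a :: "real^2^2" where
  "mat_a = vector [vector [0, 1], vector [0, 0]]"

definition mat_b :: "real^2^2" where
  "mat_b = vector [vector [0, 0], vector [1, 0]]"

definition B21_covers :: "(real^2^2) rel" where
  "B21_covers =
     {(mat 1, mat_a ** mat_b), (mat 1, mat_b ** mat_a),
      (mat_a ** mat_b, mat 0), (mat_b ** mat_a, mat 0), (mat_a, mat 0), (mat_b, mat 0)}"

definition B21_carrier :: "(real^2^2) set" where
  "B21_carrier = {mat 0, mat 1, mat_a, mat_b, mat_a ** mat_b, mat_b ** mat_a}"

definition B21_join :: "real^2^2 \<Rightarrow> real^2^2 \<Rightarrow> real^2^2" where
  "B21_join x y = (THE z. z \<in> B21_carrier \<and> (x, z) \<in> B21_covers\<^sup>* \<and> (y, z) \<in> B21_covers\<^sup>* \<and>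
     (\<forall>w\<in>B21_carrier. (x, w) \<in> B21_covers\<^sup>* \<and> (y, w) \<in> B21_covers\<^sup>* \<longrightarrow> (z, w) \<in> B21_covers\<^sup>*))"

definition B21 :: "(real^2^2) alg" where
  "B21 = \<lparr>carrier = B21_carrier, add = B21_join, mul = (**)\<rparr>"

lemma ai_semiring_adjoin_zero: "ai_semiring S \<Longrightarrow> ai_semiring (adjoin_zero S)"
  unfolding ai_semiring_def adjoin_zero_def by simp metis

lemma ai_semiring_S7: "ai_semiring S7"
proof -
  have "(\<forall>x. P x) \<longleftrightarrow> P S7_0 \<and> P S7_a \<and> P S7_1" for P
    by (metis s7.exhaust)
  then show ?thesis unfolding ai_semiring_def S7_def by simp
qed


lemmas mat2_simps = mat_a_def mat_b_def vec_eq_iff matrix_matrix_mult_def mat_def vector_2 sum_2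
  forall_2

lemma B21_distinct: "distinct [mat 0, mat 1, mat_a, mat_b, mat_a ** mat_b, mat_b ** mat_a]"
  by (simp add: mat2_simps)

lemma B21_rtrancl: "B21_covers\<^sup>* = insert (mat 1, mat 0) (B21_covers \<union> Id)"
proof
  have "(mat 1, mat 0) \<in> B21_covers O B21_covers" by (auto simp: B21_covers_def)
  then show "insert (mat 1, mat 0) (B21_covers \<union> Id) \<subseteq> B21_covers\<^sup>*"
    by (auto intro: rtrancl_trans)
  have "(x, y) \<in> insert (mat 1, mat 0) (B21_covers \<union> Id)" if "(x, y) \<in> B21_covers\<^sup>*" for x y
    using that
  proof induction
    case base
    then show ?case by simp
  next
    case (step y z)
    then show ?case using B21_distinct unfolding B21_covers_def by auto
  qed
  then show "B21_covers\<^sup>* \<subseteq> insert (mat 1, mat 0) (B21_covers \<union> Id)" by auto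
qed

lemma B21_le_iff:
  assumes "x \<in> B21_carrier"
  shows "(x, y) \<in> B21_covers\<^sup>* \<longleftrightarrow>
    x = y \<or> y = mat 0 \<or> x = mat 1 \<and> (y = mat_a ** mat_b \<or> y = mat_b ** mat_a)"
  using assms unfolding B21_rtrancl unfolding B21_covers_def B21_carrier_def
  by (simp only: insert_iff empty_iff Un_iff prod.inject pair_in_Id_conv) blast

lemma B21_join:
  assumes x: "x \<in> B21_carrier" and y: "y \<in> B21_carrier"
  shows "B21_join x y =
    (if x = y then x
     else if {x, y} = {mat 1, mat_a ** mat_b} then mat_a ** mat_b
     else if {x, y} = {mat 1, mat_b ** mat_a} then mat_b ** mat_a
     else mat 0)" (is "_ = ?z")
proof -
  let ?le = "\<lambda>x y. (x, y) \<in> B21_covers\<^sup>*"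
  have z: "?z \<in> B21_carrier" using x unfolding B21_carrier_def by (simp only: insert_iff simp_thms split: if_split)
  have ub: "?le x ?z" "?le y ?z"
    unfolding B21_le_iff[OF x] B21_le_iff[OF y] by (simp_all add: doubleton_eq_iff del: mat_0)
  have least: "?le ?z w" if "?le x w" "?le y w" for w
  proof -
    consider "x = y" | "x \<noteq> y" "{x, y} = {mat 1, mat_a ** mat_b}"
      | "x \<noteq> y" "{x, y} \<noteq> {mat 1, mat_a ** mat_b}" "{x, y} = {mat 1, mat_b ** mat_a}"
      | "x \<noteq> y" "{x, y} \<noteq> {mat 1, mat_a ** mat_b}" "{x, y} \<noteq> {mat 1, mat_b ** mat_a}" by blast
    then show ?thesis
    proof cases
      case 1
      then show ?thesis using that by simp
    next
      case 2
      show ?thesis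
        unfolding if_not_P[OF 2(1)] if_P[OF 2(2)] using 2(2) that by (auto simp: doubleton_eq_iff)
    next
      case 3
      show ?thesis
        unfolding if_not_P[OF 3(1)] if_not_P[OF 3(2)] if_P[OF 3(3)]
        using 3(3) that by (auto simp: doubleton_eq_iff)
    next
      case 4
      then have "w = mat 0"
        using that unfolding B21_le_iff[OF x] B21_le_iff[OF y] doubleton_eq_iff by blast
      then show ?thesis using B21_le_iff[OF z] by blast
    qed
  qed
  have anti: "v = w" if "v \<in> B21_carrier" "w \<in> B21_carrier" "?le v w" "?le w v" for v w
    using that(3,4) B21_distinct unfolding B21_le_iff[OF that(1)] B21_le_iff[OF that(2)]
    by auto
  show ?thesis
    unfolding B21_join_def
  proof (rule the_equality, goal_cases)
    case 1
    show ?case using z ub least by blast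
  next
    case (2 w)
    then have "?le w ?z" "?le ?z w" "w \<in> B21_carrier" using z ub least by blast+
    then show ?case using anti z by blast
  qed
qed

lemma B21_mult:
  "mat_a ** mat_a = mat 0" "mat_b ** mat_b = mat 0"
  "mat_a ** (mat_a ** mat_b) = mat 0" "mat_b ** (mat_b ** mat_a) = mat 0"
  "mat_a ** (mat_b ** mat_a) = mat_a" "mat_b ** (mat_a ** mat_b) = mat_b"
  "(mat_a ** mat_b) ** mat_a = mat_a" "(mat_b ** mat_a) ** mat_b = mat_b"
  "(mat_a ** mat_b) ** mat_b = mat 0" "(mat_b ** mat_a) ** mat_a = mat 0"
  "(mat_a ** mat_b) ** (mat_a ** mat_b) = mat_a ** mat_b"
  "(mat_b ** mat_a) ** (mat_b ** mat_a) = mat_b ** mat_a"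
  "(mat_a ** mat_b) ** (mat_b ** mat_a) = mat 0"
  "(mat_b ** mat_a) ** (mat_a ** mat_b) = mat 0"
  "mat 0 ** x = mat 0" "x ** mat 0 = mat 0" for x :: "real^2^2"
  by (simp_all add: mat2_simps)

lemma ai_semiring_B21: "ai_semiring B21"
proof -
  let ?ab = "mat_a ** mat_b" and ?ba = "mat_b ** mat_a"
  have all: "(\<forall>x\<in>B21_carrier. P x) \<longleftrightarrow> P 0 \<and> P (mat 1) \<and> P mat_a \<and> P mat_b \<and> P ?ab \<and> P ?ba" for P
    by (simp add: B21_carrier_def)
  have mem: "0 \<in> B21_carrier" "mat 1 \<in> B21_carrier" "mat_a \<in> B21_carrier"
    "mat_b \<in> B21_carrier" "?ab \<in> B21_carrier" "?ba \<in> B21_carrier"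
    by (simp_all add: B21_carrier_def)
  have d: "distinct [0, mat 1, mat_a, mat_b, ?ab, ?ba]" "distinct [?ba, ?ab, mat_b, mat_a, mat 1, 0]"
    using B21_distinct by auto
  have idem: "B21_join x x = x" if "x \<in> B21_carrier" for x
    using B21_join[OF that that] by simp
  have zero: "B21_join 0 x = 0" "B21_join x 0 = 0" if "x \<in> B21_carrier" for x
    using B21_join[OF mem(1) that] B21_join[OF that mem(1)] d by (auto simp: doubleton_eq_iff)
  have join:
    "B21_join (mat 1) ?ab = ?ab" "B21_join ?ab (mat 1) = ?ab"
    "B21_join (mat 1) ?ba = ?ba" "B21_join ?ba (mat 1) = ?ba"
    "B21_join (mat 1) mat_a = 0" "B21_join mat_a (mat 1) = 0"
    "B21_join (mat 1) mat_b = 0" "B21_join mat_b (mat 1) = 0"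
    "B21_join mat_a mat_b = 0" "B21_join mat_b mat_a = 0"
    "B21_join mat_a ?ab = 0" "B21_join ?ab mat_a = 0"
    "B21_join mat_a ?ba = 0" "B21_join ?ba mat_a = 0"
    "B21_join mat_b ?ab = 0" "B21_join ?ab mat_b = 0"
    "B21_join mat_b ?ba = 0" "B21_join ?ba mat_b = 0"
    "B21_join ?ab ?ba = 0" "B21_join ?ba ?ab = 0"
    using d by (simp_all add: B21_join mem doubleton_eq_iff)
  have ne: "B21_carrier \<noteq> {}" by (simp add: B21_carrier_def)
  show ?thesis
    unfolding ai_semiring_def B21_def alg.simps all
    by (simp add: ne mem idem zero join B21_mult[simplified])
qed


section \<open>Birkhoff's theorem\<close>

datatype 'v trm = TVar 'v | TAdd "'v trm" "'v trm" | TMul "'v trm" "'v trm"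

primrec trm_eval :: "'a alg \<Rightarrow> ('v \<Rightarrow> 'a) \<Rightarrow> 'v trm \<Rightarrow> 'a" where
  "trm_eval A v (TVar x) = v x"
| "trm_eval A v (TAdd s t) = add A (trm_eval A v s) (trm_eval A v t)"
| "trm_eval A v (TMul s t) = mul A (trm_eval A v s) (trm_eval A v t)"

definition satisfies :: "'a alg \<Rightarrow> 'v trm \<times> 'v trm \<Rightarrow> bool" where
  "satisfies A e \<longleftrightarrow>
     (\<forall>v. range v \<subseteq> carrier A \<longrightarrow> trm_eval A v (fst e) = trm_eval A v (snd e))"

definition models :: "(nat trm \<times> nat trm) set \<Rightarrow> 'a alg set" where
  "models E = {A. ai_semiring A \<and> (\<forall>e\<in>E. satisfies A e)}"

lemma trm_eval_cong: "(\<And>x. x \<in> set_trm t \<Longrightarrow> v x = w x) \<Longrightarrow> trm_eval A v t = trm_eval A w t"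
  by (induction t) auto

lemma trm_eval_map: "trm_eval A v (map_trm r t) = trm_eval A (v \<circ> r) t"
  by (induction t) auto

lemma trm_eval_closed: "ai_semiring A \<Longrightarrow> range v \<subseteq> carrier A \<Longrightarrow> trm_eval A v t \<in> carrier A"
  by (induction t) (auto simp: ai_semiring_def)

lemma trm_eval_prod:
  assumes "subuniverse B (prod_alg I F)" "range v \<subseteq> B" "i \<in> I"
  shows "trm_eval (prod_alg I F) v t i = trm_eval (F i) (\<lambda>x. v x i) t"
  using assms by (induction t) (auto simp: prod_alg_def)

lemma trm_eval_subuniverse:
  assumes "subuniverse B A" "range v \<subseteq> B"
  shows "trm_eval A v t \<in> B"
  using assms by (induction t) (auto simp: subuniverse_def)

lemma trm_eval_hom:
  assumes "subuniverse B A" "range v \<subseteq> B" "is_hom h (A\<lparr>carrier := B\<rparr>) C"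
  shows "h (trm_eval A v t) = trm_eval C (h \<circ> v) t"
proof (induction t)
  case (TVar x)
  then show ?case by simp
next
  case (TAdd s t)
  then show ?case
    using trm_eval_subuniverse[OF assms(1,2)] assms(3) by (simp add: is_hom_def)
next
  case (TMul s t)
  then show ?case
    using trm_eval_subuniverse[OF assms(1,2)] assms(3) by (simp add: is_hom_def)
qed

lemma hsp_satisfies:
  fixes e :: "'v trm \<times> 'v trm" and A :: "'a alg"
  assumes "hsp_image I F A" and F: "\<And>i. i \<in> I \<Longrightarrow> satisfies (F i) e"
  shows "satisfies A e"
  unfolding satisfies_def
proof (intro allI impI)
  fix v :: "'v \<Rightarrow> 'a" assume v: "range v \<subseteq> carrier A"
  obtain B h where B: "subuniverse B (prod_alg I F)" and
    h: "is_hom h (prod_alg I F\<lparr>carrier := B\<rparr>) A" "h ` B = carrier A"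
    using assms(1) unfolding hsp_image_def by blast
  define w where "w = (\<lambda>x. SOME b. b \<in> B \<and> h b = v x)"
  have w: "w x \<in> B \<and> h (w x) = v x" for x
  proof -
    have "v x \<in> h ` B" using v h(2) by auto
    then have "\<exists>b. b \<in> B \<and> h b = v x" by auto
    then show ?thesis unfolding w_def by (rule someI_ex)
  qed
  then have wB: "range w \<subseteq> B" and hw: "h \<circ> w = v" by auto
  have BP: "B \<subseteq> (\<Pi>\<^sub>E i\<in>I. carrier (F i))" using B by (auto simp: subuniverse_def prod_alg_def)
  have "trm_eval (prod_alg I F) w (fst e) = trm_eval (prod_alg I F) w (snd e)"
  proof
    fix i
    show "trm_eval (prod_alg I F) w (fst e) i = trm_eval (prod_alg I F) w (snd e) i"
    proof (cases "i \<in> I")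
      case True
      have "range (\<lambda>x. w x i) \<subseteq> carrier (F i)" using w BP True by (auto simp: PiE_iff)
      then show ?thesis
        using F[OF True] by (simp add: trm_eval_prod[OF B wB True] satisfies_def)
    next
      case False
      have "trm_eval (prod_alg I F) w t i = undefined" for t
      proof -
        have "trm_eval (prod_alg I F) w t \<in> (\<Pi>\<^sub>E i\<in>I. carrier (F i))"
          using trm_eval_subuniverse[OF B wB] BP by blast
        then show ?thesis using False by (rule PiE_arb)
      qed
      then show ?thesis by simp
    qed
  qed
  then show "trm_eval A v (fst e) = trm_eval A v (snd e)"
    using trm_eval_hom[OF B wB h(1), of "fst e"] trm_eval_hom[OF B wB h(1), of "snd e"]
    unfolding hw by simp
qed

lemma satisfies_eval:
  "satisfies A (s, t) \<Longrightarrow> range v \<subseteq> carrier A \<Longrightarrow> trm_eval A v s = trm_eval A v t"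
  by (simp add: satisfies_def)

lemma ai_semiring_iff:
  "ai_semiring A \<longleftrightarrow> carrier A \<noteq> {} \<and>
     (\<forall>x\<in>carrier A. \<forall>y\<in>carrier A. add A x y \<in> carrier A \<and> mul A x y \<in> carrier A) \<and>
     (let x = TVar (0::nat); y = TVar 1; z = TVar 2 in
       satisfies A (TAdd x x, x) \<and> satisfies A (TAdd x y, TAdd y x) \<and>
       satisfies A (TAdd (TAdd x y) z, TAdd x (TAdd y z)) \<and>
       satisfies A (TMul (TMul x y) z, TMul x (TMul y z)) \<and>
       satisfies A (TMul x (TAdd y z), TAdd (TMul x y) (TMul x z)) \<and>
       satisfies A (TMul (TAdd x y) z, TAdd (TMul x z) (TMul y z)))"
  (is "_ \<longleftrightarrow> ?R")
proof
  assume A: "ai_semiring A"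
  have v: "v n \<in> carrier A" if "range v \<subseteq> carrier A" for v :: "nat \<Rightarrow> 'a" and n
    using that by auto
  show ?R
    using A unfolding ai_semiring_def satisfies_def Let_def fst_conv snd_conv trm_eval.simps
    by (intro conjI allI impI) (blast intro: v)+
next
  assume R: ?R
  have val: "range (\<lambda>n::nat. if n = 0 then x else if n = 1 then y else z) \<subseteq> carrier A"
    if "x \<in> carrier A" "y \<in> carrier A" "z \<in> carrier A" for x y z
    using that by auto
  note S = satisfies_eval[OF _ val]
  have cl: "add A x y \<in> carrier A" "mul A x y \<in> carrier A"
    if "x \<in> carrier A" "y \<in> carrier A" for x y
    using R that by blast+
  have laws: "add A x x = x" "add A x y = add A y x"
    "add A (add A x y) z = add A x (add A y z)"
    "mul A (mul A x y) z = mul A x (mul A y z)"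
    "mul A x (add A y z) = add A (mul A x y) (mul A x z)"
    "mul A (add A x y) z = add A (mul A x z) (mul A y z)"
    if "x \<in> carrier A" "y \<in> carrier A" "z \<in> carrier A" for x y z
    using R S[OF _ that, of "TAdd (TVar 0) (TVar 0)" "TVar 0"]
      S[OF _ that, of "TAdd (TVar 0) (TVar 1)" "TAdd (TVar 1) (TVar 0)"]
      S[OF _ that, of "TAdd (TAdd (TVar 0) (TVar 1)) (TVar 2)"
          "TAdd (TVar 0) (TAdd (TVar 1) (TVar 2))"]
      S[OF _ that, of "TMul (TMul (TVar 0) (TVar 1)) (TVar 2)"
          "TMul (TVar 0) (TMul (TVar 1) (TVar 2))"]
      S[OF _ that, of "TMul (TVar 0) (TAdd (TVar 1) (TVar 2))"
          "TAdd (TMul (TVar 0) (TVar 1)) (TMul (TVar 0) (TVar 2))"]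
      S[OF _ that, of "TMul (TAdd (TVar 0) (TVar 1)) (TVar 2)"
          "TAdd (TMul (TVar 0) (TVar 2)) (TMul (TVar 1) (TVar 2))"]
    by (simp_all add: Let_def)
  have ne: "carrier A \<noteq> {}" using R by blast
  show "ai_semiring A"
    unfolding ai_semiring_def by (intro conjI ballI ne cl laws; assumption)
qed

lemma hsp_ai_semiring:
  assumes A: "hsp_image I F A" and F: "\<And>i. i \<in> I \<Longrightarrow> ai_semiring (F i)"
  shows "ai_semiring A"
proof -
  obtain B h where B: "subuniverse B (prod_alg I F)" and
    h: "is_hom h (prod_alg I F\<lparr>carrier := B\<rparr>) A" "h ` B = carrier A"
    using A unfolding hsp_image_def by blast
  have ne: "carrier A \<noteq> {}" using B h(2) by (auto simp: subuniverse_def)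
  have "add A x y \<in> carrier A \<and> mul A x y \<in> carrier A"
    if xy: "x \<in> carrier A" "y \<in> carrier A" for x y
  proof -
    obtain b c where bc: "b \<in> B" "c \<in> B" "x = h b" "y = h c" using xy h(2) by blast
    have "add A x y = h (add (prod_alg I F) b c)" "mul A x y = h (mul (prod_alg I F) b c)"
      using h(1) bc by (simp_all add: is_hom_def)
    moreover have "add (prod_alg I F) b c \<in> B" "mul (prod_alg I F) b c \<in> B"
      using B bc by (simp_all add: subuniverse_def)
    ultimately show ?thesis using h(2) by blast
  qed
  moreover have "satisfies A e" if "\<And>i. i \<in> I \<Longrightarrow> satisfies (F i) e" for e :: "nat trm \<times> nat trm"
    using hsp_satisfies[OF A that] .
  ultimately show ?thesis
    using ne F unfolding ai_semiring_iff Let_def by blast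
qed

lemma inj_trm:
  assumes "infinite (UNIV :: 'u set)"
  obtains f :: "'u trm \<times> 'u trm \<Rightarrow> 'u" where "inj f"
proof -
  obtain p where "bij_betw p (UNIV \<times> UNIV :: ('u \<times> 'u) set) (UNIV :: 'u set)"
    using card_of_Times_same_infinite[OF assms] card_of_ordIso by blast
  then have "inj p" by (simp add: bij_betw_def)
  then have p: "p (x, y) = p (x', y') \<longleftrightarrow> x = x' \<and> y = y'" for x y x' y'
    by (auto dest: injD)
  obtain n :: "nat \<Rightarrow> 'u" where n: "inj n"
    using assms infinite_countable_subset by blast
  define c :: "'u trm \<Rightarrow> 'u" where
    "c = rec_trm (\<lambda>x. p (n 0, x)) (\<lambda>_ _ x y. p (n 1, p (x, y))) (\<lambda>_ _ x y. p (n 2, p (x, y)))"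
  have c: "c (TVar x) = p (n 0, x)" "c (TAdd s t) = p (n 1, p (c s, c t))"
    "c (TMul s t) = p (n 2, p (c s, c t))" for x s t
    by (simp_all add: c_def)
  have "c s = c t \<Longrightarrow> s = t" for s t
  proof (induction s arbitrary: t)
    case (TVar x)
    then show ?case by (cases t) (auto simp: c p inj_eq[OF n])
  next
    case (TAdd s1 s2)
    then show ?case by (cases t) (auto simp: c p inj_eq[OF n])
  next
    case (TMul s1 s2)
    then show ?case by (cases t) (auto simp: c p inj_eq[OF n])
  qed
  then have "inj (\<lambda>(s, t). p (c s, c t))" by (auto simp: inj_def p)
  then show thesis by (rule that)
qed

lemma finite_set_trm: "finite (set_trm t)"
  by (induction t) auto

lemma satisfies_any_vars:
  fixes s t :: "'v trm"
  assumes ne: "carrier A \<noteq> {}" and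
    nat: "\<And>r :: 'v \<Rightarrow> nat. inj_on r (set_trm s \<union> set_trm t) \<Longrightarrow> satisfies A (map_trm r s, map_trm r t)"
  shows "satisfies A (s, t)"
  unfolding satisfies_def
proof (intro allI impI)
  fix v :: "'v \<Rightarrow> 'a" assume v: "range v \<subseteq> carrier A"
  let ?X = "set_trm s \<union> set_trm t"
  have "finite ?X" by (simp add: finite_set_trm)
  then obtain r :: "'v \<Rightarrow> nat" where r: "inj_on r ?X"
    by (metis finite_imp_inj_to_nat_seg)
  define w where "w = v \<circ> inv_into ?X r"
  have w: "w (r x) = v x" if "x \<in> ?X" for x
    using inv_into_f_f[OF r that] by (simp add: w_def)
  have "range w \<subseteq> carrier A" using v unfolding w_def by fastforce
  then have "trm_eval A w (map_trm r s) = trm_eval A w (map_trm r t)"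
    using nat[OF r] by (simp add: satisfies_def)
  moreover have "trm_eval A (w \<circ> r) s = trm_eval A v s" "trm_eval A (w \<circ> r) t = trm_eval A v t"
    by (rule trm_eval_cong, simp add: w)+
  ultimately show "trm_eval A v (fst (s, t)) = trm_eval A v (snd (s, t))" by (simp add: trm_eval_map)
qed

lemma satisfies_map:
  fixes r :: "'v \<Rightarrow> 'w" and A :: "'a alg"
  assumes "satisfies A (s, t)"
  shows "satisfies A (map_trm r s, map_trm r t)"
  unfolding satisfies_def fst_conv snd_conv trm_eval_map
proof (intro allI impI)
  fix v :: "'w \<Rightarrow> 'a" assume "range v \<subseteq> carrier A"
  then have "range (v \<circ> r) \<subseteq> carrier A" by fastforce
  then show "trm_eval A (v \<circ> r) s = trm_eval A (v \<circ> r) t" by (rule satisfies_eval[OF assms])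
qed

lemma models_hsp:
  assumes "hsp_image I F A" "\<And>i. i \<in> I \<Longrightarrow> F i \<in> models E"
  shows "A \<in> models E"
proof -
  have "ai_semiring A"
    by (rule hsp_ai_semiring[OF assms(1)]) (use assms(2) in \<open>simp add: models_def\<close>)
  moreover have "satisfies A e" if "e \<in> E" for e
    by (rule hsp_satisfies[OF assms(1)]) (use assms(2) that in \<open>simp add: models_def\<close>)
  ultimately show ?thesis by (simp add: models_def)
qed

lemma ai_variety_models: "ai_variety (models E :: 'u alg set)"
  unfolding ai_variety_def
proof (intro conjI allI impI)
  show "models E \<subseteq> {A. ai_semiring A}" by (auto simp: models_def)
  show "A \<in> models E" if "(\<forall>i\<in>I. F i \<in> models E) \<and> hsp_image I F A"
    for I :: "'u set" and F and A :: "'u alg"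
    by (rule models_hsp[of I F]) (use that in blast)+
qed

text \<open>The members of \<open>K\<close> may have a type different from that of \<open>A\<close>.\<close>

lemma birkhoff_hsp:
  fixes K :: "'s alg set" and A :: "'u alg"
  assumes inf: "infinite (UNIV :: 'u set)" and
    K: "\<And>S. S \<in> K \<Longrightarrow> ai_semiring S" and A: "ai_semiring A" and
    Id: "\<And>e :: nat trm \<times> nat trm. (\<And>S. S \<in> K \<Longrightarrow> satisfies S e) \<Longrightarrow> satisfies A e"
  obtains I :: "'u set" and F where "\<And>i. i \<in> I \<Longrightarrow> F i \<in> K" "hsp_image I F A"
proof -
  have Id': "satisfies A (s, t)" if st: "\<And>S. S \<in> K \<Longrightarrow> satisfies S (s, t)" for s t :: "'u trm"
  proof (rule satisfies_any_vars)
    show "carrier A \<noteq> {}" using A by (simp add: ai_semiring_def)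
    show "satisfies A (map_trm r s, map_trm r t)" for r :: "'u \<Rightarrow> nat"
      by (rule Id, rule satisfies_map, rule st)
  qed
  obtain f :: "'u trm \<times> 'u trm \<Rightarrow> 'u" where f: "inj f" using inj_trm[OF inf] by blast
  define P where "P = {e :: 'u trm \<times> 'u trm. \<exists>S\<in>K. \<not> satisfies S e}"
  have "\<exists>S v. S \<in> K \<and> range v \<subseteq> carrier S \<and> trm_eval S v (fst e) \<noteq> trm_eval S v (snd e)" if "e \<in> P" for e
    using that unfolding P_def satisfies_def by blast
  then obtain S V where SV: "\<And>e. e \<in> P \<Longrightarrow> S e \<in> K \<and> range (V e) \<subseteq> carrier (S e) \<and>
      trm_eval (S e) (V e) (fst e) \<noteq> trm_eval (S e) (V e) (snd e)"
    by metis
  define I where "I = f ` P"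
  define F where "F = (\<lambda>i. S (inv f i))"
  define W where "W = (\<lambda>i. V (inv f i))"
  have FI: "F i \<in> K \<and> range (W i) \<subseteq> carrier (F i)" if "i \<in> I" for i
  proof -
    obtain e where e: "e \<in> P" "i = f e" using \<open>i \<in> I\<close> unfolding I_def by blast
    then have "inv f i = e" using f by simp
    then show ?thesis using SV[OF e(1)] by (simp add: F_def W_def)
  qed
  define E where "E = (\<lambda>t. \<lambda>i\<in>I. trm_eval (F i) (W i) t)"
  have EP: "E t \<in> (\<Pi>\<^sub>E i\<in>I. carrier (F i))" for t
    unfolding E_def by (rule PiE_I) (simp_all add: FI K trm_eval_closed)
  have Ead: "add (prod_alg I F) (E s) (E t) = E (TAdd s t)"
    and Emu: "mul (prod_alg I F) (E s) (E t) = E (TMul s t)" for s t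
    by (auto simp: prod_alg_def E_def)
  have sub: "subuniverse (range E) (prod_alg I F)"
    unfolding subuniverse_def using EP Ead Emu by (auto simp: prod_alg_def)
  have EA: "satisfies A (s, t)" if "E s = E t" for s t
  proof (rule Id', rule ccontr)
    fix S' assume "S' \<in> K" "\<not> satisfies S' (s, t)"
    then have st: "(s, t) \<in> P" by (auto simp: P_def)
    then have "f (s, t) \<in> I" by (auto simp: I_def)
    then have "trm_eval (F (f (s, t))) (W (f (s, t))) s = trm_eval (F (f (s, t))) (W (f (s, t))) t"
      using fun_cong[OF that, of "f (s, t)"] by (simp add: E_def)
    then show False using SV[OF st] f by (simp add: F_def W_def)
  qed
  obtain a where a: "a \<in> carrier A" using A by (auto simp: ai_semiring_def)
  define g where "g = (\<lambda>u. if u \<in> carrier A then u else a)"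
  have g: "range g \<subseteq> carrier A" using a by (auto simp: g_def)
  define h where "h = (\<lambda>b. trm_eval A g (SOME t. E t = b))"
  have h: "h (E t) = trm_eval A g t" for t
  proof -
    have "E (SOME s. E s = E t) = E t" by (rule someI) simp
    from satisfies_eval[OF EA[OF this] g] show ?thesis by (simp add: h_def)
  qed
  have "is_hom h (prod_alg I F\<lparr>carrier := range E\<rparr>) A"
    unfolding is_hom_def using h trm_eval_closed[OF A g] by (auto simp: Ead Emu)
  moreover have "h ` range E = carrier A"
  proof
    show "h ` range E \<subseteq> carrier A" using h trm_eval_closed[OF A g] by auto
    show "carrier A \<subseteq> h ` range E"
    proof
      fix x assume "x \<in> carrier A"
      then have "x = h (E (TVar x))" by (simp add: h g_def)
      then show "x \<in> h ` range E" by blast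
    qed
  qed
  ultimately have "hsp_image I F A" using sub unfolding hsp_image_def by blast
  then show thesis using FI that by blast
qed

theorem birkhoff:
  fixes K :: "'u alg set"
  assumes "infinite (UNIV :: 'u set)"
  shows "ai_variety K \<longleftrightarrow> (\<exists>E. K = models E)"
proof
  assume K: "ai_variety K"
  define E where "E = {e :: nat trm \<times> nat trm. \<forall>S\<in>K. satisfies S e}"
  have "K = models E"
  proof
    show "K \<subseteq> models E" using K by (auto simp: ai_variety_def models_def E_def)
    show "models E \<subseteq> K"
    proof
      fix A :: "'u alg" assume A: "A \<in> models E"
      show "A \<in> K"
      proof (rule birkhoff_hsp[OF assms, of K A])
        show "ai_semiring S" if "S \<in> K" for S using K that by (auto simp: ai_variety_def)
        show "ai_semiring A" using A by (simp add: models_def)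
        show "satisfies A e" if "\<And>S. S \<in> K \<Longrightarrow> satisfies S e" for e :: "nat trm \<times> nat trm"
        proof -
          have "e \<in> E" using that unfolding E_def by blast
          moreover have "\<forall>e\<in>E. satisfies A e" using A by (simp add: models_def)
          ultimately show ?thesis by (rule bspec[rotated])
        qed
        show "A \<in> K" if "\<And>i. i \<in> I \<Longrightarrow> F i \<in> K" "hsp_image I F A" for I :: "'u set" and F
          using K that unfolding ai_variety_def by blast
      qed
    qed
  qed
  then show "\<exists>E. K = models E" ..
next
  assume "\<exists>E. K = models E"
  then show "ai_variety K" using ai_variety_models by blast
qed

corollary ai_variety_hsp:
  fixes K :: "'u alg set" and I :: "'i set" and A :: "'u alg"
  assumes "infinite (UNIV :: 'u set)" "ai_variety K" "\<And>i. i \<in> I \<Longrightarrow> F i \<in> K" "hsp_image I F A"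
  shows "A \<in> K"
  using assms models_hsp by (metis birkhoff)

lemma generated_variety_eq:
  fixes S :: "'s alg"
  assumes inf: "infinite (UNIV :: 'u set)" and S: "ai_semiring S" "finite (carrier S)"
  shows "(generated_variety S :: 'u alg set) = models {e. satisfies S e}"
proof -
  have sub: "subuniverse (carrier S) S" using S(1) by (auto simp: subuniverse_def ai_semiring_def)
  have sat: "satisfies S e \<longleftrightarrow> satisfies A e" if iso: "isomorphic S A"
    for A :: "'u alg" and e :: "nat trm \<times> nat trm"
  proof -
    obtain h where h: "is_hom h S A" "bij_betw h (carrier S) (carrier A)"
      using iso unfolding isomorphic_def by blast
    have hom: "h (trm_eval S v t) = trm_eval A (h \<circ> v) t" if "range v \<subseteq> carrier S" for v :: "nat \<Rightarrow> 's" and t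
      using trm_eval_hom[OF sub that, of h A] h(1) by simp
    show ?thesis
    proof
      assume e: "satisfies S e"
      show "satisfies A e"
        unfolding satisfies_def
      proof (intro allI impI)
        fix w :: "nat \<Rightarrow> 'u" assume w: "range w \<subseteq> carrier A"
        define v where "v = inv_into (carrier S) h \<circ> w"
        have v: "range v \<subseteq> carrier S"
          using w bij_betw_inv_into[OF h(2)] by (auto simp: v_def bij_betw_def)
        have "h \<circ> v = w"
          using w bij_betw_inv_into_right[OF h(2)] by (fastforce simp: v_def)
        then show "trm_eval A w (fst e) = trm_eval A w (snd e)"
          using hom[OF v] e v unfolding satisfies_def by metis
      qed
    next
      assume e: "satisfies A e"
      show "satisfies S e"
        unfolding satisfies_def
      proof (intro allI impI)
        fix v :: "nat \<Rightarrow> 's" assume v: "range v \<subseteq> carrier S"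
        then have "range (h \<circ> v) \<subseteq> carrier A" using h(2) by (auto simp: bij_betw_def)
        then have "h (trm_eval S v (fst e)) = h (trm_eval S v (snd e))"
          using e hom[OF v] by (simp add: satisfies_def)
        then show "trm_eval S v (fst e) = trm_eval S v (snd e)"
          using h(2) trm_eval_closed[OF S(1) v] by (auto simp: bij_betw_def dest: inj_onD)
      qed
    qed
  qed
  obtain A :: "'u alg" where A: "ai_semiring A" "isomorphic S A"
  proof -
    obtain T :: "'u set" where "finite T" "card T = card (carrier S)"
      using infinite_arbitrarily_large[OF inf] by blast
    then obtain f where f: "bij_betw f (carrier S) T"
      using finite_same_card_bij[OF S(2)] by metis
    define g where "g = inv_into (carrier S) f"
    have gf: "g (f x) = x" if "x \<in> carrier S" for x
      using bij_betw_inv_into_left[OF f that] by (simp add: g_def)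
    define A where "A = \<lparr>carrier = f ` carrier S, add = (\<lambda>x y. f (add S (g x) (g y))),
      mul = (\<lambda>x y. f (mul S (g x) (g y)))\<rparr>"
    have "isomorphic S A"
      unfolding isomorphic_def
    proof (intro exI conjI)
      show "is_hom f S A" by (simp add: is_hom_def A_def gf)
      show "bij_betw f (carrier S) (carrier A)" using f by (simp add: A_def bij_betw_def)
    qed
    moreover have "ai_semiring A"
    proof -
      have cl: "add S x y \<in> carrier S" "mul S x y \<in> carrier S"
        if "x \<in> carrier S" "y \<in> carrier S" for x y
        using S(1) that unfolding ai_semiring_def by blast+
      then have "carrier A \<noteq> {} \<and>
          (\<forall>x\<in>carrier A. \<forall>y\<in>carrier A. add A x y \<in> carrier A \<and> mul A x y \<in> carrier A)"
        using S(1) by (auto simp: A_def gf ai_semiring_def)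
      then show ?thesis
        using S(1) sat[OF \<open>isomorphic S A\<close>] unfolding ai_semiring_iff Let_def by blast
    qed
    ultimately show thesis by (rule that[rotated])
  qed
  have "A \<in> models {e. satisfies S e}" using A(1) sat[OF A(2)] by (simp add: models_def)
  then have "generated_variety S \<subseteq> (models {e. satisfies S e} :: 'u alg set)"
    unfolding generated_variety_def using A ai_variety_models by blast
  moreover have "models {e. satisfies S e} \<subseteq> K"
    if K: "ai_variety K" "B \<in> K" "isomorphic S B" for K and B :: "'u alg"
  proof -
    obtain E where E: "K = models E" using K(1) birkhoff[OF inf] by blast
    have "satisfies S e" if "e \<in> E" for e
      using that K(2) sat[OF K(3)] unfolding E models_def by blast
    then show ?thesis unfolding E models_def by blast
  qed
  ultimately show ?thesis unfolding generated_variety_def by blast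
qed

end

theory Submission
  imports Defs "HOL-Library.Infinite_Set" "HOL-Number_Theory.Cong"
begin

text \<open>
  For \<open>n \<ge> 2\<close> let \<open>p\<^sub>n\<close> be the sum of the words \<open>x\<^sub>0 y\<^sub>j z\<^sub>j\<close> and \<open>x\<^sub>1 y\<^sub>j z\<^sub>j\<^sub>+\<^sub>1\<close> over all \<open>j\<close> modulo \<open>n\<close>,
  and consider the identity \<open>p\<^sub>n + x\<^sub>0 y\<^sub>0 z\<^sub>1 = p\<^sub>n\<close>. Suppose that the letters have degrees in an abelian
  group such that all words in \<open>p\<^sub>n\<close> have the same degree. Then \<open>z\<^sub>j\<^sub>+\<^sub>1\<close> and \<open>z\<^sub>j\<close> differ by a constant \<open>d\<close>,
  and \<open>n d = 0\<close> because the indices are cyclic. If the group has no \<open>n\<close>-torsion, then \<open>d = 0\<close>, and the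
  word \<open>x\<^sub>0 y\<^sub>0 z\<^sub>1\<close> has the same degree as those in \<open>p\<^sub>n\<close> (lemma \<open>cyclic_cong\<close>).

  The matrices in \<open>B\<^sub>2\<^sup>1\<close> are graded by the integers. Therefore \<open>B\<^sub>2\<^sup>1\<close> satisfies all these identities
  (\<open>B21_cycle_identity\<close>), and so does \<open>S\<^sub>7\<close>, which is the subalgebra \<open>{0, a, 1}\<close>. A finite algebra
  graded by the integers modulo \<open>m\<close>, called \<open>torsion_alg m\<close>, satisfies the identity for \<open>n\<close> if \<open>m\<close> and \<open>n\<close>
  are coprime, and violates it if \<open>m = n\<close>. As \<open>m\<close> and \<open>n\<close> run through the primes, each of
  these algebras violates exactly one of these identities.

  What remains is that \<open>torsion_alg m\<close> belongs to the variety of \<open>S\<^sub>7\<^sup>0\<close>, and hence to that of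
  \<open>(B\<^sub>2\<^sup>1)\<^sup>0\<close> (\<open>torsion_alg_satisfies\<close>). Sending variables to the adjoined zero removes all words that
  contain them, so an identity of \<open>S\<^sub>7\<^sup>0\<close> is an identity of \<open>S\<^sub>7\<close> in every subset of the variables. This
  has the following effect: if the letters in each word of one side have disjoint sets of colours with
  a common union, then every word of the other side is one of these words, and so its residue is right
  as well. The same family thus yields continuum many varieties in
  both intervals, and there are no more because identities are countable in number
  (\<open>interval_continuum\<close>).
\<close>

section \<open>Counting the varieties in an interval\<close>

lemma embedding_satisfies:
  assumes A: "ai_semiring A" and h: "is_hom h A B" "inj_on h (carrier A)" and B: "satisfies B e"
  shows "satisfies A e"
  unfolding satisfies_def
proof (intro allI impI)
  fix v :: "'c \<Rightarrow> 'a" assume v: "range v \<subseteq> carrier A"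
  have sub: "subuniverse (carrier A) A" using A by (auto simp: subuniverse_def ai_semiring_def)
  have hom: "h (trm_eval A v t) = trm_eval B (h \<circ> v) t" for t
    using trm_eval_hom[OF sub v, of h B] h(1) by simp
  have "range (h \<circ> v) \<subseteq> carrier B" using v h(1) by (auto simp: is_hom_def)
  then have "h (trm_eval A v (fst e)) = h (trm_eval A v (snd e))"
    using B by (simp add: hom satisfies_def)
  then show "trm_eval A v (fst e) = trm_eval A v (snd e)"
    using h(2) trm_eval_closed[OF A v] by (auto dest: inj_onD)
qed

lemma is_hom_Some: "is_hom Some S (adjoin_zero S)"
  by (auto simp: is_hom_def adjoin_zero_def)

lemma adjoin_zero_embedding:
  assumes "is_hom h A B" "inj_on h (carrier A)"
  shows "is_hom (map_option h) (adjoin_zero A) (adjoin_zero B)"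
    "inj_on (map_option h) (carrier (adjoin_zero A))"
  using assms by (auto simp: is_hom_def adjoin_zero_def inj_on_def)

text \<open>
  Without a copy of \<open>A\<close> the generated variety would be an empty intersection, hence would contain
  all algebras, even those that are not ai-semirings.
\<close>

lemma finite_copy:
  fixes A :: "'a alg"
  assumes inf: "infinite (UNIV :: 'u set)" and A: "ai_semiring A" "finite (carrier A)"
  obtains B :: "'u alg" where "ai_semiring B"
    "\<And>e :: nat trm \<times> nat trm. satisfies B e \<longleftrightarrow> satisfies A e"
proof -
  have "\<not> ai_semiring (\<lparr>carrier = {}, add = undefined, mul = undefined\<rparr> :: 'u alg)"
    by (simp add: ai_semiring_def)
  then have "(generated_variety A :: 'u alg set) \<noteq> UNIV"
    unfolding generated_variety_eq[OF inf A] models_def by auto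
  then obtain K and B :: "'u alg" where K: "ai_variety K" "B \<in> K" and iso: "isomorphic A B"
    unfolding generated_variety_def by blast
  have B: "ai_semiring B" using K by (auto simp: ai_variety_def)
  obtain h where h: "is_hom h A B" and bij: "bij_betw h (carrier A) (carrier B)"
    using iso unfolding isomorphic_def by blast
  let ?g = "inv_into (carrier A) h"
  have g: "bij_betw ?g (carrier B) (carrier A)" by (rule bij_betw_inv_into[OF bij])
  have gh: "?g (h x) = x" if "x \<in> carrier A" for x
    by (rule bij_betw_inv_into_left[OF bij that])
  have "is_hom ?g B A"
    unfolding is_hom_def
  proof (intro conjI ballI)
    show "?g ` carrier B \<subseteq> carrier A" using g by (simp add: bij_betw_def)
    fix x y assume "x \<in> carrier B" "y \<in> carrier B"
    then obtain a b where ab: "a \<in> carrier A" "b \<in> carrier A" "x = h a" "y = h b"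
      using bij unfolding bij_betw_def by blast
    then have "add B x y = h (add A a b)" "mul B x y = h (mul A a b)"
      "add A a b \<in> carrier A" "mul A a b \<in> carrier A"
      using h A(1) by (auto simp: is_hom_def ai_semiring_def)
    then show "?g (add B x y) = add A (?g x) (?g y)" "?g (mul B x y) = mul A (?g x) (?g y)"
      using ab gh by auto
  qed
  then have "satisfies B e \<longleftrightarrow> satisfies A e" for e :: "nat trm \<times> nat trm"
    using embedding_satisfies[OF A(1) h] embedding_satisfies[OF B] bij g
    unfolding bij_betw_def by blast
  then show thesis using B that by blast
qed

text \<open>
  A variety is determined by its identities, and these form a subset of a countable set.
\<close>

lemma varieties_lepoll:
  assumes inf: "infinite (UNIV :: 'u set)"
  shows "{M :: 'u alg set. ai_variety M} \<lesssim> (UNIV :: nat set set)"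
proof -
  define Id where "Id M = {e :: nat trm \<times> nat trm. \<forall>A\<in>M. satisfies A e}" for M :: "'u alg set"
  have M: "models (Id M) = M" if "ai_variety M" for M
  proof -
    have "\<exists>E. M = models E" using that unfolding birkhoff[OF inf] .
    then obtain E where E: "M = models E" ..
    have "E \<subseteq> Id M" unfolding E Id_def models_def by auto
    then have "models (Id M) \<subseteq> models E" unfolding models_def by blast
    moreover have "M \<subseteq> models (Id M)" unfolding E Id_def models_def by auto
    ultimately show ?thesis unfolding E by (rule subset_antisym)
  qed
  obtain f :: "nat trm \<times> nat trm \<Rightarrow> nat" where f: "inj f"
    using inj_trm[OF infinite_UNIV_nat] by blast
  have "inj_on (\<lambda>M. f ` Id M) {M. ai_variety M}"
    by (rule inj_on_inverseI[where g = "\<lambda>X. models (f -` X)"])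
      (simp add: inj_vimage_image_eq[OF f] M)
  then show ?thesis unfolding lepoll_def by (intro exI[where x = "\<lambda>M. f ` Id M"]) simp
qed

text \<open>
  To a set \<open>T\<close> of indices assign the variety defined by the identities of \<open>S\<^sup>0\<close> together with all
  \<open>\<epsilon> n\<close> for \<open>n \<notin> T\<close>. It lies in the interval because the \<open>\<epsilon> n\<close> hold in \<open>S\<close>, and it contains \<open>A n\<close> exactly
  if \<open>n \<in> T\<close>, so \<open>T\<close> can be recovered from it.
\<close>

lemma interval_continuum:
  fixes S :: "'s alg" and A :: "nat \<Rightarrow> 'a alg" and \<epsilon> :: "nat \<Rightarrow> nat trm \<times> nat trm"
  assumes inf: "infinite (UNIV :: 'u set)"
    and S: "ai_semiring S" "finite (carrier S)" "\<And>n. satisfies S (\<epsilon> n)"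
    and A: "\<And>n. ai_semiring (A n)" "\<And>n. finite (carrier (A n))"
      "\<And>n (e :: nat trm \<times> nat trm). satisfies (adjoin_zero S) e \<Longrightarrow> satisfies (A n) e"
    and sep: "\<And>m n. satisfies (A m) (\<epsilon> n) \<longleftrightarrow> m \<noteq> n"
  shows "(variety_interval (generated_variety S) (generated_variety (adjoin_zero S))
      :: 'u alg set set) \<approx> (UNIV :: nat set set)" (is "?I \<approx> _")
proof (rule lepoll_antisym)
  have "?I \<subseteq> {M. ai_variety M}" by (auto simp: variety_interval_def)
  then show "?I \<lesssim> (UNIV :: nat set set)"
    using varieties_lepoll[OF inf] subset_imp_lepoll lepoll_trans by blast
next
  define V :: "nat set \<Rightarrow> 'u alg set"
    where "V T = models ({e. satisfies (adjoin_zero S) e} \<union> \<epsilon> ` (- T))" for T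
  have fin: "finite (carrier (adjoin_zero S))" using S(2) by (simp add: adjoin_zero_def)
  have S0: "satisfies S e" if "satisfies (adjoin_zero S) e" for e :: "nat trm \<times> nat trm"
    using embedding_satisfies[OF S(1) is_hom_Some _ that] by simp
  have V: "V T \<in> ?I" for T
  proof -
    have "ai_variety (V T)" unfolding V_def by (rule ai_variety_models)
    moreover have "models {e. satisfies S e} \<subseteq> V T"
      using S0 S(3) unfolding V_def models_def by blast
    moreover have "V T \<subseteq> models {e. satisfies (adjoin_zero S) e}"
      unfolding V_def models_def by blast
    ultimately show ?thesis
      unfolding variety_interval_def generated_variety_eq[OF inf S(1,2)]
        generated_variety_eq[OF inf ai_semiring_adjoin_zero[OF S(1)] fin] by blast
  qed
  have sub: "T \<subseteq> T'" if "V T = V T'" for T T'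
  proof
    fix n assume n: "n \<in> T"
    obtain B :: "'u alg" where B: "ai_semiring B"
      "\<And>e :: nat trm \<times> nat trm. satisfies B e \<longleftrightarrow> satisfies (A n) e"
      using finite_copy[OF inf A(1,2)] by blast
    have "B \<in> V T" using n B A(3) sep unfolding V_def models_def by blast
    then have "\<forall>k\<in>-T'. satisfies (A n) (\<epsilon> k)"
      using B(2) unfolding that unfolding V_def models_def by blast
    then show "n \<in> T'" using sep by blast
  qed
  have "inj V" by (rule injI, rule subset_antisym; rule sub) simp_all
  moreover have "range V \<subseteq> ?I" using V by (rule image_subsetI)
  ultimately have "inj V \<and> range V \<subseteq> ?I" by (rule conjI)
  then show "(UNIV :: nat set set) \<lesssim> ?I" unfolding lepoll_def by (rule exI[where x = V])
qed

section \<open>Words of a term\<close>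

text \<open>
  Expanding a term by distributivity turns it into a sum of words. The order of the letters is
  forgotten, since words only serve for evaluations in which it does not matter.
\<close>

primrec words :: "'v trm \<Rightarrow> 'v multiset set" where
  "words (TVar x) = {{#x#}}"
| "words (TAdd s t) = words s \<union> words t"
| "words (TMul s t) = (\<lambda>(u, w). u + w) ` (words s \<times> words t)"

lemma words_nonempty: "words t \<noteq> {}"
  by (induction t) auto

text \<open>
  The new zero absorbs products and is neutral for sums, so a word that contains it is simply
  dropped from the sum. With a suitable valuation one thus tests whether a term has a word inside a
  given set of letters.
\<close>

lemma adjoin_zero_eval_None:
  "trm_eval (adjoin_zero S) v t = None \<longleftrightarrow> (\<forall>u\<in>words t. \<exists>x\<in>#u. v x = None)"
proof (induction t)
  case (TMul s t)
  have "trm_eval (adjoin_zero S) v (TMul s t) = None \<longleftrightarrow>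
      trm_eval (adjoin_zero S) v s = None \<or> trm_eval (adjoin_zero S) v t = None"
    by (auto simp: adjoin_zero_def split: option.splits)
  also have "\<dots> \<longleftrightarrow> (\<forall>p\<in>words s. \<forall>q\<in>words t. \<exists>x\<in>#p + q. v x = None)"
    unfolding TMul using words_nonempty[of s] words_nonempty[of t] by (auto simp: bex_Un)
  finally show ?case by simp
next
  case (TAdd s t)
  have "trm_eval (adjoin_zero S) v (TAdd s t) = None \<longleftrightarrow>
      trm_eval (adjoin_zero S) v s = None \<and> trm_eval (adjoin_zero S) v t = None"
    by (auto simp: adjoin_zero_def split: option.splits)
  then show ?case unfolding TAdd by (simp add: ball_Un)
qed simp

lemma adjoin_zero_eval_Some:
  "trm_eval (adjoin_zero S) (\<lambda>x. Some (v x)) t = Some (trm_eval S v t)"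
  by (induction t) (auto simp: adjoin_zero_def)

lemma S7_simps [simp]:
  "add S7 x y = (if x = y then x else S7_0)"
  "mul S7 x y = (if x = S7_1 then y else if y = S7_1 then x else S7_0)"
  by (simp_all add: S7_def)

lemma S7_mul_nonzero:
  "mul S7 x y \<noteq> S7_0 \<Longrightarrow> x \<noteq> S7_0 \<and> y \<noteq> S7_0 \<and> (x = S7_1 \<or> y = S7_1)"
  by (cases x; cases y) simp_all

text \<open>
  In \<open>S\<^sub>7\<close> unequal summands give \<open>0\<close>, and a product of letters \<open>a\<close> and \<open>1\<close> is determined by the
  number of letters \<open>a\<close> as long as it is at most one. So a value other than \<open>0\<close> forces every word to
  contain the same number, at most one, of letters \<open>a\<close>.
\<close>

lemma S7_eval_words:
  assumes "trm_eval S7 v t \<noteq> S7_0" "u \<in> words t"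
  shows "(\<forall>x\<in>#u. v x \<noteq> S7_0) \<and>
    (\<Sum>x\<in>#u. of_bool (v x = S7_a)) = (of_bool (trm_eval S7 v t = S7_a) :: nat)"
  using assms
proof (induction t arbitrary: u)
  case (TVar x)
  then show ?case by simp
next
  case (TAdd s t)
  then have "trm_eval S7 v s = trm_eval S7 v t" by (simp split: if_splits)
  then show ?case using TAdd by auto
next
  case (TMul s t)
  from TMul.prems(2) obtain p q where pq: "p \<in> words s" "q \<in> words t" "u = p + q" by auto
  have st: "trm_eval S7 v s \<noteq> S7_0" "trm_eval S7 v t \<noteq> S7_0"
    "trm_eval S7 v s = S7_1 \<or> trm_eval S7 v t = S7_1"
    using S7_mul_nonzero[OF TMul.prems(1)[unfolded trm_eval.simps]] by blast+
  show ?case using TMul.IH(1)[OF st(1) pq(1)] TMul.IH(2)[OF st(2) pq(2)] st(3)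
    unfolding pq(3) by (elim disjE) (simp_all add: ball_Un)
qed

section \<open>A family of algebras with torsion\<close>

definition rgb :: "nat multiset" where "rgb = {#0, 1, 2#}"

text \<open>
  An element other than the top \<open>None\<close> carries a nonempty set of colours, encoded as a multiset, and
  a residue modulo \<open>m\<close>. Products add both and become \<open>None\<close> as soon as a colour is repeated; the sum of
  different elements is \<open>None\<close>. The residues are the source of \<open>m\<close>-torsion, and the colours are what
  \<open>S\<^sub>7\<close> can see. Nonempty colour sets make every letter of a word visible.
\<close>

definition torsion_alg :: "nat \<Rightarrow> (nat multiset \<times> int) option alg" where
  "torsion_alg m = \<lparr>
     carrier = insert None (Some ` ({M. M \<noteq> {#} \<and> M \<subseteq># rgb} \<times> {0..<int m})),
     add = (\<lambda>x y. if x = y then x else None),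
     mul = (\<lambda>x y. case x of None \<Rightarrow> None | Some (M, r) \<Rightarrow> (case y of None \<Rightarrow> None
       | Some (N, s) \<Rightarrow> if M + N \<subseteq># rgb then Some (M + N, (r + s) mod int m) else None))\<rparr>"

lemma torsion_alg_simps [simp]:
  "carrier (torsion_alg m) = insert None (Some ` ({M. M \<noteq> {#} \<and> M \<subseteq># rgb} \<times> {0..<int m}))"
  "add (torsion_alg m) x y = (if x = y then x else None)"
  "mul (torsion_alg m) None y = None"
  "mul (torsion_alg m) x None = None"
  "mul (torsion_alg m) (Some (M, r)) (Some (N, s)) =
    (if M + N \<subseteq># rgb then Some (M + N, (r + s) mod int m) else None)"
  by (auto simp: torsion_alg_def split: option.splits)

lemma rgb_left: "M + N \<subseteq># rgb \<Longrightarrow> M \<subseteq># rgb" and rgb_right: "M + N \<subseteq># rgb \<Longrightarrow> N \<subseteq># rgb"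
  by (meson mset_subset_eq_add_left mset_subset_eq_add_right subset_mset.order_trans)+

lemma torsion_mul_eq_Some:
  "mul (torsion_alg m) x y = Some (N, r) \<longleftrightarrow> (\<exists>M1 r1 M2 r2. x = Some (M1, r1) \<and> y = Some (M2, r2) \<and>
    N = M1 + M2 \<and> r = (r1 + r2) mod int m \<and> N \<subseteq># rgb)"
  by (cases x; cases y) (auto split: if_splits)

lemma count_rgb: "M \<subseteq># rgb \<Longrightarrow> count M c \<le> 1"
  using mset_subset_eq_count[of M rgb c] by (simp add: rgb_def split: if_splits)

lemma finite_torsion_alg: "finite (carrier (torsion_alg m))"
proof -
  have "M = mset_set (set_mset M)" if "M \<subseteq># rgb" for M
  proof (rule multiset_eqI)
    fix c
    show "count M c = count (mset_set (set_mset M)) c"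
      using count_rgb[OF that, of c] by (cases "c \<in># M") (auto simp: le_Suc_eq count_eq_zero_iff)
  qed
  moreover have "set_mset M \<in> Pow (set_mset rgb)" if "M \<subseteq># rgb" for M
    using set_mset_mono[OF that] by blast
  ultimately have "{M. M \<subseteq># rgb} \<subseteq> mset_set ` Pow (set_mset rgb)" by blast
  then have "finite {M. M \<subseteq># rgb}" by (rule finite_subset) simp
  then show ?thesis by simp
qed

text \<open>
  In an algebra in which unequal summands give an absorbing top, distributivity amounts to
  cancellation: \<open>x y = x z \<noteq> None\<close> implies \<open>y = z\<close>. Here it holds because multisets and residues
  cancel.
\<close>

lemma ai_semiring_torsion_alg:
  assumes "m > 0"
  shows "ai_semiring (torsion_alg m)"
proof -
  let ?A = "torsion_alg m"
  have cl: "mul ?A x y \<in> carrier ?A" if "x \<in> carrier ?A" "y \<in> carrier ?A" for x y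
    using that assms by (cases x; cases y) auto
  have assoc: "mul ?A (mul ?A x y) z = mul ?A x (mul ?A y z)" for x y z
  proof -
    consider "x = None \<or> y = None \<or> z = None"
      | M1 r1 M2 r2 M3 r3 where "x = Some (M1, r1)" "y = Some (M2, r2)" "z = Some (M3, r3)"
      by (cases x; cases y; cases z) auto
    then show ?thesis
    proof cases
      case 1
      then show ?thesis by auto
    next
      case 2
      have "M1 + M2 + M3 \<subseteq># rgb \<Longrightarrow> M1 + M2 \<subseteq># rgb" "M1 + (M2 + M3) \<subseteq># rgb \<Longrightarrow> M2 + M3 \<subseteq># rgb"
        using rgb_left rgb_right by blast+
      then show ?thesis unfolding 2 by (simp add: add.assoc mod_simps)
    qed
  qed
  have comm: "mul ?A x y = mul ?A y x" for x y
    by (cases x; cases y) (auto simp: add.commute)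
  have cancel: "y = z" if eq: "mul ?A x y = mul ?A x z" "mul ?A x y \<noteq> None"
    and yz: "y \<in> carrier ?A" "z \<in> carrier ?A" for x y z
  proof -
    obtain N r where "mul ?A x y = Some (N, r)" using eq(2) by auto
    then obtain M s M1 r1 M2 r2 where x: "x = Some (M, s)" and y: "y = Some (M1, r1)"
      and z: "z = Some (M2, r2)" and e: "M + M1 = M + M2" "(s + r1) mod int m = (s + r2) mod int m"
      using eq(1) by (auto simp: torsion_mul_eq_Some)
    have "r1 mod int m = r2 mod int m" using e(2) by (metis add_diff_cancel_left' mod_diff_left_eq)
    then show ?thesis using e(1) yz unfolding y z by auto
  qed
  have distr: "mul ?A x (add ?A y z) = add ?A (mul ?A x y) (mul ?A x z)"
    if "y \<in> carrier ?A" "z \<in> carrier ?A" for x y z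
  proof (cases "y = z")
    case False
    then have "mul ?A x y = mul ?A x z \<longrightarrow> mul ?A x y = None" using cancel that by blast
    then show ?thesis using False by auto
  qed simp
  have distr': "mul ?A (add ?A y z) x = add ?A (mul ?A y x) (mul ?A z x)"
    if "y \<in> carrier ?A" "z \<in> carrier ?A" for x y z
    using distr[OF that] comm by metis
  have ad: "add ?A x y \<in> carrier ?A" "add ?A x x = x" "add ?A x y = add ?A y x"
    "add ?A (add ?A x y) z = add ?A x (add ?A y z)"
    if "x \<in> carrier ?A" "y \<in> carrier ?A" "z \<in> carrier ?A" for x y z
    using that by auto
  have ne: "carrier ?A \<noteq> {}" by simp
  show ?thesis
    unfolding ai_semiring_def
    by (intro conjI ballI ne cl assoc distr distr' ad; assumption)
qed

abbreviation hue :: "(nat multiset \<times> int) option \<Rightarrow> nat multiset" where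
  "hue x \<equiv> case x of None \<Rightarrow> {#} | Some (M, r) \<Rightarrow> M"

abbreviation weight :: "(nat multiset \<times> int) option \<Rightarrow> int" where
  "weight x \<equiv> case x of None \<Rightarrow> 0 | Some (M, r) \<Rightarrow> r"

text \<open>
  The word \<open>u\<close> multiplies to the element with colours \<open>N\<close> and residue \<open>r\<close>, up to the requirement that
  no colour is repeated.
\<close>

definition word_value :: "nat \<Rightarrow> ('v \<Rightarrow> (nat multiset \<times> int) option) \<Rightarrow> 'v multiset \<Rightarrow>
    nat multiset \<Rightarrow> int \<Rightarrow> bool" where
  "word_value m v u N r \<longleftrightarrow> (\<forall>x\<in>#u. v x \<noteq> None) \<and> (\<Sum>x\<in>#u. hue (v x)) = N \<and>
     [(\<Sum>x\<in>#u. weight (v x)) = r] (mod (int m))"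

lemma torsion_eval_Some:
  assumes v: "range v \<subseteq> carrier (torsion_alg m)"
    and e: "trm_eval (torsion_alg m) v t = Some (N, r)" and u: "u \<in> words t"
  shows "word_value m v u N r"
  using e u
proof (induction t arbitrary: u N r)
  case (TVar x)
  then show ?case by (simp add: word_value_def)
next
  case (TAdd s t)
  then show ?case by (auto split: if_splits)
next
  case (TMul s t)
  from TMul.prems(2) obtain p q where pq: "p \<in> words s" "q \<in> words t" "u = p + q" by auto
  from TMul.prems(1) obtain M1 r1 M2 r2 where
    st: "trm_eval (torsion_alg m) v s = Some (M1, r1)" "trm_eval (torsion_alg m) v t = Some (M2, r2)"
    and N: "N = M1 + M2" "r = (r1 + r2) mod int m"
    by (auto simp: torsion_mul_eq_Some)
  show ?case
    using TMul.IH(1)[OF st(1) pq(1)] TMul.IH(2)[OF st(2) pq(2)] unfolding pq(3) N word_value_def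
    by (auto simp: cong_def intro: mod_add_cong)
qed

text \<open>
  The induction passes through a product because fixing one word of the second factor determines,
  by cancellation, a common value of all words of the first factor, and vice versa.
\<close>

lemma torsion_eval_if_words:
  assumes v: "range v \<subseteq> carrier (torsion_alg m)"
    and N: "N \<subseteq># rgb" and u: "\<And>u. u \<in> words t \<Longrightarrow> word_value m v u N r"
  shows "trm_eval (torsion_alg m) v t = Some (N, r mod int m)"
  using N u
proof (induction t arbitrary: N r)
  case (TVar x)
  have "word_value m v {#x#} N r" by (rule TVar.prems) simp
  then obtain r' where r': "v x = Some (N, r')" "[r' = r] (mod (int m))"
    by (auto simp: word_value_def)
  have "v x \<in> carrier (torsion_alg m)" using v by blast
  then have "0 \<le> r'" "r' < int m" unfolding r' by auto
  then show ?case using r' by (simp add: cong_def)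
next
  case (TAdd s t)
  then have "trm_eval (torsion_alg m) v s = Some (N, r mod int m)"
    "trm_eval (torsion_alg m) v t = Some (N, r mod int m)"
    by (metis UnCI words.simps(2))+
  then show ?case by simp
next
  case (TMul s t)
  obtain p0 q0 where pq0: "p0 \<in> words s" "q0 \<in> words t" using words_nonempty by blast
  have val: "word_value m v (p + q) N r" if "p \<in> words s" "q \<in> words t" for p q
    by (rule TMul.prems) (use that in auto)
  define M1 r1 M2 r2 where M1: "M1 = (\<Sum>x\<in>#p0. hue (v x))" and r1: "r1 = (\<Sum>x\<in>#p0. weight (v x))"
    and M2: "M2 = (\<Sum>x\<in>#q0. hue (v x))" and r2: "r2 = (\<Sum>x\<in>#q0. weight (v x))"
  have N12: "M1 + M2 = N" "[r1 + r2 = r] (mod (int m))"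
    using val[OF pq0] by (auto simp: word_value_def M1 M2 r1 r2)
  have s: "word_value m v p M1 r1" if "p \<in> words s" for p
  proof -
    have "(\<Sum>x\<in>#p. hue (v x)) + M2 = M1 + M2"
      "[(\<Sum>x\<in>#p. weight (v x)) + r2 = r1 + r2] (mod (int m))" "\<forall>x\<in>#p. v x \<noteq> None"
      using val[OF that pq0(2)] N12
      by (auto simp: word_value_def M2 r2 intro: cong_trans cong_sym)
    then show ?thesis by (simp add: word_value_def cong_add_rcancel)
  qed
  have t: "word_value m v q M2 r2" if "q \<in> words t" for q
  proof -
    have "M1 + (\<Sum>x\<in>#q. hue (v x)) = M1 + M2"
      "[r1 + (\<Sum>x\<in>#q. weight (v x)) = r1 + r2] (mod (int m))" "\<forall>x\<in>#q. v x \<noteq> None"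
      using val[OF pq0(1) that] N12
      by (auto simp: word_value_def M1 r1 intro: cong_trans cong_sym)
    then show ?thesis by (simp add: word_value_def cong_add_lcancel)
  qed
  have "M1 \<subseteq># rgb" "M2 \<subseteq># rgb"
    using TMul.prems(1) rgb_left rgb_right N12(1) by blast+
  then have "trm_eval (torsion_alg m) v s = Some (M1, r1 mod int m)"
    "trm_eval (torsion_alg m) v t = Some (M2, r2 mod int m)"
    using TMul.IH s t by blast+
  then show ?case using N12 TMul.prems(1) by (simp add: cong_def mod_add_eq)
qed

text \<open>
  For each colour \<open>c\<close> the map sending elements with \<open>c\<close> to \<open>a\<close>, those without \<open>c\<close> to \<open>1\<close> and the top to
  \<open>0\<close> respects products that are not \<open>None\<close>, since these have no repeated colour.
\<close>

lemma torsion_eval_S7: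
  assumes "trm_eval (torsion_alg m) v t = Some (N, r)"
  shows "trm_eval S7 (\<lambda>x. case v x of None \<Rightarrow> S7_0 | Some (M, _) \<Rightarrow> if c \<in># M then S7_a else S7_1) t
    = (if c \<in># N then S7_a else S7_1)" (is "trm_eval S7 ?\<phi> t = _")
  using assms
proof (induction t arbitrary: N r)
  case (TVar x)
  then show ?case by simp
next
  case (TAdd s t)
  then have "trm_eval (torsion_alg m) v s = Some (N, r)" "trm_eval (torsion_alg m) v t = Some (N, r)"
    by (auto split: if_splits)
  then show ?case using TAdd.IH by simp
next
  case (TMul s t)
  from TMul.prems obtain M1 r1 M2 r2 where
    st: "trm_eval (torsion_alg m) v s = Some (M1, r1)" "trm_eval (torsion_alg m) v t = Some (M2, r2)"
    and N: "N = M1 + M2" "N \<subseteq># rgb"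
    by (auto simp: torsion_mul_eq_Some)
  have "count N c \<le> 1" by (rule count_rgb[OF N(2)])
  then have "count M1 c + count M2 c \<le> 1" unfolding N(1) by simp
  then have "count M1 c = 0 \<or> count M2 c = 0" by linarith
  then have "\<not> (c \<in># M1 \<and> c \<in># M2)" by (simp add: count_eq_zero_iff)
  then show ?case using TMul.IH(1)[OF st(1)] TMul.IH(2)[OF st(2)] N(1) by auto
qed

section \<open>Membership of these algebras in the variety of \<open>S\<^sub>7\<^sup>0\<close>\<close>

text \<open>
  Let \<open>u\<close> be a word of \<open>t\<close>. The valuations in \<open>S\<^sub>7\<close> belonging to the single colours show that \<open>u\<close> has
  the colours \<open>N\<close>. Sending the letters of \<open>u\<close> to \<open>1\<close> and all others to the adjoined zero shows that \<open>s\<close>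
  has a word \<open>w\<close> with letters from \<open>u\<close> only. Since \<open>w\<close> has the colours \<open>N\<close> too, no colour occurs twice
  in them, and every letter has a colour, \<open>w\<close> and \<open>u\<close> are equal. So the words of \<open>t\<close> are among those
  of \<open>s\<close>.
\<close>

lemma torsion_eval_transfer:
  assumes m: "m > 0" and st: "satisfies (adjoin_zero S7) (s, t)"
    and v: "range v \<subseteq> carrier (torsion_alg m)"
    and e: "trm_eval (torsion_alg m) v s = Some (N, r)"
  shows "trm_eval (torsion_alg m) v t = Some (N, r)"
proof -
  have "Some (N, r) \<in> carrier (torsion_alg m)"
    unfolding e[symmetric] using ai_semiring_torsion_alg[OF m] v by (rule trm_eval_closed)
  then have N: "N \<subseteq># rgb" and r: "0 \<le> r" "r < int m" by auto
  have hue: "hue (v x) \<noteq> {#}" "hue (v x) \<subseteq># rgb" if "v x \<noteq> None" for x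
    using that v by (auto dest!: subsetD[OF _ rangeI, of v _ x])
  have "word_value m v u N r" if u: "u \<in> words t" for u
  proof -
    define \<phi> where "\<phi> c x = (case v x of None \<Rightarrow> S7_0
      | Some (M, _) \<Rightarrow> if c \<in># M then S7_a else S7_1)" for c x
    have \<phi>: "(\<forall>x\<in>#u. \<phi> c x \<noteq> S7_0) \<and>
      (\<Sum>x\<in>#u. of_bool (\<phi> c x = S7_a)) = (of_bool (c \<in># N) :: nat)" for c
    proof -
      have "trm_eval (adjoin_zero S7) (\<lambda>x. Some (\<phi> c x)) s = trm_eval (adjoin_zero S7) (\<lambda>x. Some (\<phi> c x)) t"
        by (rule satisfies_eval[OF st]) (auto simp: adjoin_zero_def S7_def)
      then have "trm_eval S7 (\<phi> c) t = trm_eval S7 (\<phi> c) s" by (simp add: adjoin_zero_eval_Some)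
      also have "\<dots> = (if c \<in># N then S7_a else S7_1)"
        using torsion_eval_S7[OF e] unfolding \<phi>_def .
      finally show ?thesis using S7_eval_words[OF _ u, of "\<phi> c"] by (auto split: if_splits)
    qed
    have nn: "v x \<noteq> None" if "x \<in># u" for x
    proof -
      have "\<phi> 0 x \<noteq> S7_0" using \<phi> that by blast
      then show ?thesis by (cases "v x") (auto simp: \<phi>_def)
    qed
    have "count (\<Sum>x\<in>#u. hue (v x)) c = count N c" for c
    proof -
      have "count (hue (v x)) c = of_bool (\<phi> c x = S7_a)" if "x \<in># u" for x
      proof -
        obtain M k where M: "v x = Some (M, k)" using nn \<open>x \<in># u\<close> by fastforce
        show ?thesis using count_rgb[OF hue(2)[OF nn[OF that]], of c]
          by (auto simp: M \<phi>_def le_Suc_eq count_eq_zero_iff)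
      qed
      then have "count (\<Sum>x\<in>#u. hue (v x)) c = (\<Sum>x\<in>#u. of_bool (\<phi> c x = S7_a))"
        by (induction u) auto
      also have "\<dots> = of_bool (c \<in># N)" using \<phi> by blast
      also have "\<dots> = count N c" using count_rgb[OF N, of c] by (auto simp: le_Suc_eq count_eq_zero_iff)
      finally show ?thesis .
    qed
    then have uN: "(\<Sum>x\<in>#u. hue (v x)) = N" by (rule multiset_eqI)
    define \<psi> where "\<psi> x = (if x \<in># u then Some S7_1 else None)" for x
    have "trm_eval (adjoin_zero S7) \<psi> s = trm_eval (adjoin_zero S7) \<psi> t"
      by (rule satisfies_eval[OF st]) (auto simp: adjoin_zero_def S7_def \<psi>_def)
    moreover have "trm_eval (adjoin_zero S7) \<psi> t \<noteq> None"
      using u by (auto simp: adjoin_zero_eval_None \<psi>_def)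
    ultimately have "trm_eval (adjoin_zero S7) \<psi> s \<noteq> None" by simp
    then obtain w where w: "w \<in> words s" "\<not> (\<exists>x\<in>#w. \<psi> x = None)"
      unfolding adjoin_zero_eval_None by blast
    have wu: "x \<in># u" if "x \<in># w" for x
      using w(2) that by (auto simp: \<psi>_def split: if_splits)
    have wN: "word_value m v w N r" by (rule torsion_eval_Some[OF v e w(1)])
    \<comment> \<open>A letter occurring twice would repeat its colours, which \<open>N\<close> does not.\<close>
    have le1: "count w x \<le> 1" for x
    proof (rule ccontr)
      assume "\<not> count w x \<le> 1"
      then have "{#x, x#} \<subseteq># w" by (auto intro!: mset_subset_eqI)
      then obtain w' where w': "w = {#x, x#} + w'" by (metis subset_mset.add_diff_inverse)
      have "x \<in># u" using wu w' by auto
      then obtain c where "c \<in># hue (v x)" using hue(1)[OF nn] by blast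
      then have "count (hue (v x)) c \<ge> 1" by simp
      moreover have "hue (v x) + hue (v x) + (\<Sum>x\<in>#w'. hue (v x)) = N"
        using wN by (simp add: word_value_def w' add.assoc)
      then have "count N c = count (hue (v x)) c + count (hue (v x)) c + count (\<Sum>x\<in>#w'. hue (v x)) c"
        by auto
      ultimately show False using count_rgb[OF N, of c] by linarith
    qed
    have "count w x \<le> count u x" for x
    proof (cases "x \<in># w")
      case True
      then have "1 \<le> count u x" using wu by simp
      then show ?thesis using le1[of x] by (rule order_trans[rotated])
    qed (simp add: not_in_iff)
    then have "w \<subseteq># u" by (rule mset_subset_eqI)
    then obtain w' where w': "u = w + w'" by (metis subset_mset.add_diff_inverse)
    \<comment> \<open>Since \<open>w\<close> already has all the colours, none are left for the rest of \<open>u\<close>.\<close>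
    have "(\<Sum>x\<in>#w'. hue (v x)) = {#}" using uN wN by (simp add: word_value_def w')
    then have "w' = {#}" using hue(1) nn by (cases w') (auto simp: w')
    then show ?thesis using wN w' by simp
  qed
  then have "trm_eval (torsion_alg m) v t = Some (N, r mod int m)"
    by (rule torsion_eval_if_words[OF v N])
  then show ?thesis using r by simp
qed

lemma torsion_alg_satisfies:
  fixes e :: "'v trm \<times> 'v trm"
  assumes m: "m > 0" and e: "satisfies (adjoin_zero S7) e"
  shows "satisfies (torsion_alg m) e"
  unfolding satisfies_def
proof (intro allI impI)
  fix v :: "'v \<Rightarrow> _" assume v: "range v \<subseteq> carrier (torsion_alg m)"
  have st: "satisfies (adjoin_zero S7) (fst e, snd e)" "satisfies (adjoin_zero S7) (snd e, fst e)"
    using e by (simp_all add: satisfies_def)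
  have iff: "trm_eval (torsion_alg m) v (fst e) = Some z \<longleftrightarrow>
      trm_eval (torsion_alg m) v (snd e) = Some z" for z
    using torsion_eval_transfer[OF m st(1) v, of "fst z" "snd z"]
      torsion_eval_transfer[OF m st(2) v, of "fst z" "snd z"] unfolding prod.collapse by (rule iffI)
  show "trm_eval (torsion_alg m) v (fst e) = trm_eval (torsion_alg m) v (snd e)"
  proof (cases "trm_eval (torsion_alg m) v (fst e)")
    case None
    then show ?thesis using iff by (cases "trm_eval (torsion_alg m) v (snd e)") fastforce+
  next
    case (Some z)
    then show ?thesis using iffD1[OF iff Some] by (rule trans[OF _ sym])
  qed
qed

section \<open>The cycle identities\<close>

text \<open>
  The equations for \<open>i = 0\<close> and \<open>i = 1\<close> with the same \<open>j\<close> show that \<open>c (j + 1) - c j\<close> is the constant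
  \<open>d = a 0 - a 1\<close>. Going once round the cycle gives \<open>n d = 0\<close>, hence \<open>d = 0\<close>. The case \<open>m = 0\<close> is the one
  of the integers.
\<close>

lemma cyclic_cong:
  fixes a b c :: "nat \<Rightarrow> int"
  assumes n: "2 \<le> n"
    and eq: "\<And>i j. i < 2 \<Longrightarrow> j < n \<Longrightarrow> [a i + b j + c ((i + j) mod n) = s] (mod m)"
    and torsion: "\<And>d. m dvd int n * d \<Longrightarrow> m dvd d"
  shows "[c 1 = c 0] (mod m)"
proof -
  define d where "d = a 0 - a 1"
  have step: "m dvd c (Suc j mod n) - c j - d" if "j < n" for j
  proof -
    have "m dvd (a 1 + b j + c (Suc j mod n) - s) - (a 0 + b j + c j - s)"
      by (rule dvd_diff) (use eq[of 0 j] eq[of 1 j] that in \<open>simp_all add: cong_iff_dvd_diff\<close>)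
    then show ?thesis by (simp add: d_def algebra_simps)
  qed
  have "m dvd c (j mod n) - c 0 - int j * d" if "j \<le> n" for j
    using that
  proof (induction j)
    case (Suc j)
    then have j: "j < n" by simp
    have "m dvd (c (j mod n) - c 0 - int j * d) + (c (Suc j mod n) - c j - d)"
      by (rule dvd_add[OF Suc.IH step[OF j]]) (use j in simp)
    moreover have "(c j - c 0 - int j * d) + (C - c j - d) = C - c 0 - int (Suc j) * d" for C
      by (simp add: distrib_right)
    ultimately show ?case unfolding mod_less[OF j] by (rule back_subst[where P = "(dvd) m"])
  qed simp
  from this[of n] have "m dvd int n * d" by simp
  then have "m dvd d" by (rule torsion)
  moreover have "m dvd c 1 - c 0 - d" using step[of 0] n by simp
  ultimately have "m dvd (c 1 - c 0 - d) + d" by (rule dvd_add[rotated])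
  then show ?thesis by (simp add: cong_iff_dvd_diff)
qed

text \<open>
  The word \<open>x\<^sub>i y\<^sub>j z\<^sub>k\<close> in the variables \<open>x\<^sub>i = i\<close> for \<open>i < 2\<close>, \<open>y\<^sub>j = 2 j + 2\<close> and \<open>z\<^sub>k = 2 k + 3\<close>,
  which are pairwise distinct.
\<close>

definition cycle_word :: "nat \<Rightarrow> nat \<Rightarrow> nat \<Rightarrow> nat trm" where
  "cycle_word i j k = TMul (TMul (TVar i) (TVar (2 * j + 2))) (TVar (2 * k + 3))"

text \<open>
  The sum of the words \<open>x\<^sub>0 y\<^sub>j z\<^sub>j\<close> and \<open>x\<^sub>1 y\<^sub>j z\<^sub>j\<^sub>+\<^sub>1\<close> with \<open>j\<close> modulo \<open>n\<close>. The word \<open>x\<^sub>0 y\<^sub>0 z\<^sub>0\<close>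
  that starts the fold is one of them.
\<close>

definition cycle_sum :: "nat \<Rightarrow> nat trm" where
  "cycle_sum n = foldr TAdd
     [cycle_word i j ((i + j) mod n). i \<leftarrow> [0..<2], j \<leftarrow> [0..<n]] (cycle_word 0 0 0)"

definition cycle_identity :: "nat \<Rightarrow> nat trm \<times> nat trm" where
  "cycle_identity n = (TAdd (cycle_sum n) (cycle_word 0 0 1), cycle_sum n)"

lemma words_cycle_word [simp]: "words (cycle_word i j k) = {{#i, 2 * j + 2, 2 * k + 3#}}"
  by (simp add: cycle_word_def)

lemma words_foldr_TAdd: "words (foldr TAdd ts t) = (\<Union>s\<in>set ts. words s) \<union> words t"
  by (induction ts) auto

lemma words_cycle_sum:
  assumes "2 \<le> n"
  shows "words (cycle_sum n) = (\<Union>i<2. \<Union>j<n. words (cycle_word i j ((i + j) mod n)))"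
proof -
  have "words (cycle_word 0 0 0) \<subseteq> (\<Union>i<2. \<Union>j<n. words (cycle_word i j ((i + j) mod n)))"
    using assms by (intro order_trans[OF _ UN_upper[of 0]] order_trans[OF _ UN_upper[of 0]]) auto
  then show ?thesis unfolding cycle_sum_def words_foldr_TAdd
    by (simp add: Un_absorb2 atLeast0LessThan del: words_cycle_word)
qed



lemma mset_cycle_word_sum: "(\<Sum>x\<in>#{#i, j, k#}. f x) = f i + (f j + f k)" for f :: "_ \<Rightarrow> 'a::comm_monoid_add"
  by simp

text \<open>
  If the left-hand side is not \<open>None\<close>, all words of the sum have the same value. Comparing residues
  modulo \<open>m\<close>, where multiplication by \<open>n\<close> is injective, and multiplicities of each colour, which are
  integers, shows that \<open>z\<^sub>0\<close> and \<open>z\<^sub>1\<close> have the same value. So \<open>x\<^sub>0 y\<^sub>0 z\<^sub>1\<close> has that of \<open>x\<^sub>0 y\<^sub>0 z\<^sub>0\<close>.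
\<close>

lemma torsion_alg_cycle_identity:
  assumes n: "2 \<le> n" and m: "m > 0" and "coprime m n"
  shows "satisfies (torsion_alg m) (cycle_identity n)"
  unfolding satisfies_def cycle_identity_def fst_conv snd_conv
proof (intro allI impI)
  let ?A = "torsion_alg m"
  fix v :: "nat \<Rightarrow> _" assume v: "range v \<subseteq> carrier ?A"
  show "trm_eval ?A v (TAdd (cycle_sum n) (cycle_word 0 0 1)) = trm_eval ?A v (cycle_sum n)"
  proof (cases "trm_eval ?A v (cycle_sum n)")
    case None
    then show ?thesis by simp
  next
    case (Some z)
    obtain N r where z: "trm_eval ?A v (cycle_sum n) = Some (N, r)" using Some by (cases z) auto
    have "Some (N, r) \<in> carrier ?A"
      unfolding z[symmetric] using ai_semiring_torsion_alg[OF m] v by (rule trm_eval_closed)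
    then have N: "N \<subseteq># rgb" and r: "r mod int m = r" by auto
    have val: "word_value m v {#i, 2 * j + 2, 2 * ((i + j) mod n) + 3#} N r" if "i < 2" "j < n" for i j
      using torsion_eval_Some[OF v z] that unfolding words_cycle_sum[OF n] by auto
    have "[weight (v (2 * 1 + 3)) = weight (v (2 * 0 + 3))] (mod (int m))"
    proof (rule cyclic_cong[where n = n and c = "\<lambda>k. weight (v (2 * k + 3))"
          and a = "\<lambda>i. weight (v i)" and b = "\<lambda>j. weight (v (2 * j + 2))", OF n])
      show "[weight (v i) + weight (v (2 * j + 2)) + weight (v (2 * ((i + j) mod n) + 3)) = r]
          (mod (int m))" if "i < 2" "j < n" for i j
        using val[OF that] unfolding word_value_def mset_cycle_word_sum by (simp add: add.assoc)
      show "int m dvd d" if "int m dvd int n * d" for d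
        using that \<open>coprime m n\<close> by (simp add: coprime_dvd_mult_right_iff)
    qed
    moreover have "hue (v (2 * 1 + 3)) = hue (v (2 * 0 + 3))"
    proof (rule multiset_eqI)
      fix q
      have "[int (count (hue (v (2 * 1 + 3))) q) = int (count (hue (v (2 * 0 + 3))) q)] (mod 0)"
      proof (rule cyclic_cong[where n = n and c = "\<lambda>k. int (count (hue (v (2 * k + 3))) q)"
            and a = "\<lambda>i. int (count (hue (v i)) q)"
            and b = "\<lambda>j. int (count (hue (v (2 * j + 2))) q)" and s = "int (count N q)", OF n])
        show "[int (count (hue (v i)) q) + int (count (hue (v (2 * j + 2))) q) +
            int (count (hue (v (2 * ((i + j) mod n) + 3))) q) = int (count N q)] (mod 0)"
          if "i < 2" "j < n" for i j
          using val[OF that] unfolding word_value_def mset_cycle_word_sum by auto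
        show "0 dvd d" if "0 dvd int n * d" for d
          using that n by simp
      qed
      then show "count (hue (v (2 * 1 + 3))) q = count (hue (v (2 * 0 + 3))) q" by simp
    qed
    moreover have "word_value m v {#0, 2, 3#} N r" "v 5 \<noteq> None"
      using val[of 0 0] val[of 1 0] n by (simp_all add: word_value_def numeral_2_eq_2)
    ultimately have "word_value m v {#0, 2, 5#} N r"
      unfolding word_value_def mset_cycle_word_sum
      by (auto simp: cong_def) (metis mod_add_right_eq)
    then have "trm_eval ?A v (cycle_word 0 0 1) = Some (N, r mod int m)"
      by (intro torsion_eval_if_words[OF v N]) (simp add: numeral_2_eq_2)
    then show ?thesis using z r by simp
  qed
qed

text \<open>
  Give \<open>x\<^sub>i\<close>, \<open>y\<^sub>j\<close> and \<open>z\<^sub>k\<close> three different colours and the residues \<open>- i\<close>, \<open>- j\<close> and \<open>k\<close>. Then all words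
  of the sum have residue \<open>0\<close> modulo \<open>n\<close>, but \<open>x\<^sub>0 y\<^sub>0 z\<^sub>1\<close> has residue \<open>1\<close>.
\<close>

lemma torsion_alg_not_cycle_identity:
  assumes n: "2 \<le> n"
  shows "\<not> satisfies (torsion_alg n) (cycle_identity n)"
proof
  let ?A = "torsion_alg n"
  \<comment> \<open>Half of \<open>y\<^sub>j = 2 j + 2\<close> and of \<open>z\<^sub>k = 2 k + 3\<close>, rounded down, is \<open>j + 1\<close> and \<open>k + 1\<close>.\<close>
  define v where "v x = (if x < 2 then Some ({#0#}, (- int x) mod int n)
    else if even x then Some ({#1#}, (1 - int (x div 2)) mod int n)
    else Some ({#2::nat#}, (int (x div 2) - 1) mod int n))" for x :: nat
  have v_simps: "i < 2 \<Longrightarrow> v i = Some ({#0#}, (- int i) mod int n)"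
    "v (2 * j + 2) = Some ({#1#}, (- int j) mod int n)"
    "v (2 * k + 3) = Some ({#2#}, int k mod int n)" for i j k
    by (simp_all add: v_def)
  have v: "range v \<subseteq> carrier ?A"
    using n by (auto simp: v_def rgb_def)
  have val: "word_value n v {#i, 2 * j + 2, 2 * k + 3#} rgb
      (- int i + (- int j + int k))" if "i < 2" for i j k
  proof -
    \<comment> \<open>The names keep the simplifier from rearranging the arithmetic on the variables.\<close>
    define y z where "y = 2 * j + 2" and "z = 2 * k + 3"
    have "v i = Some ({#0#}, (- int i) mod int n)" "v y = Some ({#1#}, (- int j) mod int n)"
      "v z = Some ({#2#}, int k mod int n)" using that by (simp_all only: y_def z_def v_simps)
    moreover have "[(- int i) mod int n + ((- int j) mod int n + int k mod int n)
        = - int i + (- int j + int k)] (mod (int n))"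
      by (intro cong_add) simp_all
    ultimately show ?thesis
      unfolding y_def[symmetric] z_def[symmetric] word_value_def mset_cycle_word_sum
      by (simp add: rgb_def)
  qed
  have cyc: "word_value n v {#i, 2 * j + 2, 2 * ((i + j) mod n) + 3#} rgb 0" if "i < 2" for i j
  proof -
    have "[- int i + (- int j + int ((i + j) mod n)) = - int i + (- int j + int (i + j))] (mod (int n))"
      by (intro cong_add cong_refl) (simp add: zmod_int)
    then have "[- int i + (- int j + int ((i + j) mod n)) = 0] (mod (int n))" by simp
    then show ?thesis using val[OF that, of j "(i + j) mod n"]
      unfolding word_value_def using cong_trans by blast
  qed
  have "trm_eval ?A v (cycle_sum n) = Some (rgb, 0 mod int n)"
    by (rule torsion_eval_if_words[OF v]) (use cyc in \<open>auto simp: words_cycle_sum[OF n]\<close>)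
  moreover have "trm_eval ?A v (cycle_word 0 0 1) = Some (rgb, 1 mod int n)"
    by (rule torsion_eval_if_words[OF v]) (use val[of 0 0 1] in auto)
  moreover assume "satisfies ?A (cycle_identity n)"
  then have "trm_eval ?A v (TAdd (cycle_sum n) (cycle_word 0 0 1)) = trm_eval ?A v (cycle_sum n)"
    using v unfolding satisfies_def cycle_identity_def by simp
  ultimately show False using n by (simp split: if_splits)
qed

section \<open>Matrices as a graded algebra\<close>

text \<open>
  Row and column numbers as integers, so that they can be subtracted.
\<close>

definition pos :: "2 \<Rightarrow> int" where "pos r = (if r = 1 then 1 else 2)"

lemma inj_pos: "pos r = pos s \<Longrightarrow> r = s"
  using exhaust_2[of r] exhaust_2[of s] by (auto simp: pos_def)

lemma B21_entry: "x \<in> B21_carrier \<Longrightarrow> x $ r $ s = 0 \<or> x $ r $ s = 1"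
  using exhaust_2[of r] exhaust_2[of s]
  by (auto simp: B21_carrier_def mat2_simps)

text \<open>
  The integer grading: \<open>a\<close> has degree \<open>1\<close>, \<open>b\<close> has degree \<open>- 1\<close>, and the other matrices have degree
  \<open>0\<close>.
\<close>

lemma B21_homogeneous:
  assumes "x \<in> B21_carrier"
  shows "\<exists>d. \<forall>r s. x $ r $ s \<noteq> 0 \<longrightarrow> pos s - pos r = d"
proof -
  consider "x = mat 0 \<or> x = mat 1 \<or> x = mat_a ** mat_b \<or> x = mat_b ** mat_a" | "x = mat_a" | "x = mat_b"
    using assms unfolding B21_carrier_def by blast
  then show ?thesis
  proof cases
    case 1
    then show ?thesis by (intro exI[of _ 0]) (auto simp: mat2_simps pos_def)
  next
    case 2
    then show ?thesis by (intro exI[of _ 1]) (simp add: mat2_simps pos_def)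
  next
    case 3
    then show ?thesis by (intro exI[of _ "- 1"]) (simp add: mat2_simps pos_def)
  qed
qed

text \<open>
  The order of \<open>B\<^sub>2\<^sup>1\<close> is the reverse of the entrywise order of 0-1 matrices, and so joins are
  entrywise minima.
\<close>

lemma B21_join_entry:
  assumes "x \<in> B21_carrier" "y \<in> B21_carrier"
  shows "B21_join x y $ r $ s = x $ r $ s * y $ r $ s"
proof -
  have "\<forall>r s. B21_join x y $ r $ s = x $ r $ s * y $ r $ s"
    unfolding B21_join[OF assms] using assms unfolding B21_carrier_def
    by (elim insertE emptyE) (simp_all add: doubleton_eq_iff mat2_simps)
  then show ?thesis by blast
qed

lemma B21_mult_entry:
  assumes "x \<in> B21_carrier" "y \<in> B21_carrier"
  shows "(x ** y) $ r $ s \<noteq> 0 \<longleftrightarrow> (\<exists>t. x $ r $ t \<noteq> 0 \<and> y $ t $ s \<noteq> 0)"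
proof -
  have nonneg: "0 \<le> x $ r $ t * y $ t $ s" for t
    using B21_entry[OF assms(1), of r t] B21_entry[OF assms(2), of t s] by auto
  have "(x ** y) $ r $ s = (\<Sum>t\<in>UNIV. x $ r $ t * y $ t $ s)"
    by (simp add: matrix_matrix_mult_def)
  then show ?thesis using nonneg by (simp add: sum_nonneg_eq_0_iff)
qed

lemma B21_sum_entry:
  assumes v: "range v \<subseteq> B21_carrier" and P: "trm_eval B21 v (foldr TAdd ts t) $ r $ s \<noteq> 0"
    and u: "u \<in> set ts"
  shows "trm_eval B21 v u $ r $ s \<noteq> 0"
proof -
  have cl: "trm_eval B21 v t \<in> B21_carrier" for t
    using trm_eval_closed[OF ai_semiring_B21, of v] v by (simp add: B21_def)
  show ?thesis using P u
  proof (induction ts)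
    case (Cons q ts)
    have "trm_eval B21 v (foldr TAdd (q # ts) t) =
        B21_join (trm_eval B21 v q) (trm_eval B21 v (foldr TAdd ts t))"
      by (simp add: B21_def)
    then show ?case using Cons B21_join_entry[OF cl cl] by auto
  qed simp
qed

text \<open>
  Suppose the sum has a nonzero entry in row \<open>r\<close> and column \<open>s\<close>. Then so has each of its words, which
  gives a path from \<open>r\<close> to \<open>s\<close> through nonzero entries of its three factors, and the degrees of the
  factors add up to the degree of that entry. Hence \<open>z\<^sub>0\<close> and \<open>z\<^sub>1\<close> have the same degree. As both have a
  nonzero entry in column \<open>s\<close>, these entries are in the same row, and so \<open>z\<^sub>1\<close> can replace \<open>z\<^sub>0\<close> in the
  path for \<open>x\<^sub>0 y\<^sub>0 z\<^sub>0\<close>.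
\<close>

lemma B21_cycle_identity:
  assumes n: "2 \<le> n"
  shows "satisfies B21 (cycle_identity n)"
  unfolding satisfies_def cycle_identity_def fst_conv snd_conv
proof (intro allI impI)
  fix v :: "nat \<Rightarrow> _" assume "range v \<subseteq> carrier B21"
  then have v: "range v \<subseteq> B21_carrier" "v x \<in> B21_carrier" for x by (auto simp: B21_def)
  have cl: "trm_eval B21 v t \<in> B21_carrier" for t
    using trm_eval_closed[OF ai_semiring_B21, of v] v(1) by (simp add: B21_def)
  have mcl: "x ** y \<in> B21_carrier" if "x \<in> B21_carrier" "y \<in> B21_carrier" for x y
    using ai_semiring_B21 that by (simp add: ai_semiring_def B21_def)
  let ?P = "trm_eval B21 v (cycle_sum n)" and ?W = "trm_eval B21 v (cycle_word 0 0 1)"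
  have word: "trm_eval B21 v (cycle_word i j k) $ r $ s \<noteq> 0 \<longleftrightarrow>
      (\<exists>p q. v i $ r $ p \<noteq> 0 \<and> v (2 * j + 2) $ p $ q \<noteq> 0 \<and> v (2 * k + 3) $ q $ s \<noteq> 0)" for i j k r s
    by (simp add: cycle_word_def B21_def B21_mult_entry mcl v(2)) blast
  obtain d where d: "v x $ r $ s \<noteq> 0 \<Longrightarrow> pos s - pos r = d x" for x r s
    using B21_homogeneous[OF v(2)] by metis
  have "?P $ r $ s * ?W $ r $ s = ?P $ r $ s" for r s
  proof (cases "?P $ r $ s = 0")
    case False
    have path: "\<exists>p q. v i $ r $ p \<noteq> 0 \<and> v (2 * j + 2) $ p $ q \<noteq> 0 \<and>
        v (2 * ((i + j) mod n) + 3) $ q $ s \<noteq> 0" if "i < 2" "j < n" for i j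
      unfolding word[symmetric]
      by (rule B21_sum_entry[OF v(1) False[unfolded cycle_sum_def]]) (use that in \<open>auto intro!: bexI[of _ i]\<close>)
    have "[d (2 * 1 + 3) = d (2 * 0 + 3)] (mod 0)"
    proof (rule cyclic_cong[where n = n and c = "\<lambda>k. d (2 * k + 3)" and a = d
          and b = "\<lambda>j. d (2 * j + 2)", OF n])
      show "[d i + d (2 * j + 2) + d (2 * ((i + j) mod n) + 3) = pos s - pos r] (mod 0)"
        if "i < 2" "j < n" for i j
      proof -
        obtain p q where "v i $ r $ p \<noteq> 0" "v (2 * j + 2) $ p $ q \<noteq> 0"
          "v (2 * ((i + j) mod n) + 3) $ q $ s \<noteq> 0" using path[OF \<open>i < 2\<close> \<open>j < n\<close>] by blast
        from this[THEN d] show ?thesis by simp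
      qed
      show "0 dvd d" if "0 dvd int n * d" for d
        using that n by simp
    qed
    then have d10: "d 5 = d 3" by simp
    obtain p q where pq: "v 0 $ r $ p \<noteq> 0" "v 2 $ p $ q \<noteq> 0" "v 3 $ q $ s \<noteq> 0"
      using path[of 0 0] n by (auto simp: numeral_2_eq_2)
    obtain q' where q': "v 5 $ q' $ s \<noteq> 0" using path[of 1 0] n by auto
    have "q' = q" using d[OF pq(3)] d[OF q'] d10 by (intro inj_pos) simp
    then have "?W $ r $ s \<noteq> 0" using pq q' unfolding word by (auto simp: numeral_2_eq_2)
    then show ?thesis using B21_entry[OF cl, of "cycle_word 0 0 1" r s] by simp
  qed simp
  then have "B21_join ?P ?W = ?P" by (simp add: vec_eq_iff B21_join_entry[OF cl cl])
  then show "trm_eval B21 v (TAdd (cycle_sum n) (cycle_word 0 0 1)) = ?P"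
    by (simp add: B21_def)
qed

text \<open>
  The subset \<open>{0, a, 1}\<close> of \<open>B\<^sub>2\<^sup>1\<close> is a subalgebra isomorphic to \<open>S\<^sub>7\<close>.
\<close>

definition S7_matrix :: "s7 \<Rightarrow> real^2^2" where
  "S7_matrix = case_s7 (mat 0) mat_a (mat 1)"

lemma S7_matrix_embedding: "is_hom S7_matrix S7 B21" "inj_on S7_matrix (carrier S7)"
proof -
  have mem: "mat 0 \<in> B21_carrier" "mat_a \<in> B21_carrier" "mat 1 \<in> B21_carrier"
    by (simp_all add: B21_carrier_def)
  have d: "mat 0 \<noteq> (mat 1 :: real^2^2)" "mat 0 \<noteq> mat_a" "mat 1 \<noteq> mat_a"
    using B21_distinct by auto
  show inj: "inj_on S7_matrix (carrier S7)"
    using d by (auto simp: inj_on_def S7_matrix_def split: s7.splits)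
  have join: "B21_join x y = mat 0" if "x \<in> {mat 0, mat_a, mat 1}" "y \<in> {mat 0, mat_a, mat 1}" "x \<noteq> y" for x y
  proof -
    have "x \<in> B21_carrier" "y \<in> B21_carrier" using that mem by blast+
    from B21_join[OF this] show ?thesis using that B21_distinct by (auto simp: doubleton_eq_iff)
  qed
  have in3: "S7_matrix x \<in> {mat 0, mat_a, mat 1}" for x
    by (cases x) (auto simp: S7_matrix_def)
  have cl: "S7_matrix x \<in> B21_carrier" for x
    using mem by (cases x) (simp_all add: S7_matrix_def)
  have add: "S7_matrix (add S7 x y) = B21_join (S7_matrix x) (S7_matrix y)" for x y
  proof (cases "x = y")
    case True
    from B21_join[OF cl cl, of y y] True show ?thesis by simp
  next
    case False
    then have "S7_matrix x \<noteq> S7_matrix y" using inj by (auto simp: inj_on_def S7_def)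
    then show ?thesis using join[OF in3 in3] False by (simp add: S7_matrix_def)
  qed
  have mul: "S7_matrix (mul S7 x y) = S7_matrix x ** S7_matrix y" for x y
    by (cases x; cases y) (simp_all add: S7_matrix_def B21_mult[simplified])
  show "is_hom S7_matrix S7 B21"
    unfolding is_hom_def using cl add mul by (auto simp: B21_def)
qed

section \<open>The two intervals\<close>

theorem corollary3p8:
  assumes "infinite (UNIV :: 'u set)"
  shows
    "(variety_interval (generated_variety S7) (generated_variety (adjoin_zero S7))
        :: 'u alg set set) \<approx> (UNIV :: nat set set) \<and>
     (variety_interval (generated_variety B21) (generated_variety (adjoin_zero B21))
        :: 'u alg set set) \<approx> (UNIV :: nat set set)"
proof
  define p where "p = enumerate {p :: nat. prime p}"
  have p: "prime (p n)" for n
    using enumerate_in_set[OF primes_infinite, of n] by (simp add: p_def)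
  have p2: "2 \<le> p n" and p0: "0 < p n" for n using p by (simp_all add: prime_ge_2_nat prime_gt_0_nat)
  have pp: "coprime (p m) (p n)" if "m \<noteq> n" for m n
  proof (rule primes_coprime[OF p p])
    show "p m \<noteq> p n" using that inj_enumerate[OF primes_infinite] by (auto simp: p_def inj_def)
  qed
  have sep: "satisfies (torsion_alg (p m)) (cycle_identity (p n)) \<longleftrightarrow> m \<noteq> n" for m n
    using torsion_alg_cycle_identity[OF p2 p0 pp] torsion_alg_not_cycle_identity[OF p2] by blast
  have S7_if_B21: "satisfies S7 e" if "satisfies B21 e" for e :: "nat trm \<times> nat trm"
    by (rule embedding_satisfies[OF ai_semiring_S7 S7_matrix_embedding that])
  have S70_if_B210: "satisfies (adjoin_zero S7) e" if "satisfies (adjoin_zero B21) e"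
    for e :: "nat trm \<times> nat trm"
    by (rule embedding_satisfies[OF ai_semiring_adjoin_zero[OF ai_semiring_S7]
          adjoin_zero_embedding[OF S7_matrix_embedding] that])
  show "(variety_interval (generated_variety S7) (generated_variety (adjoin_zero S7))
      :: 'u alg set set) \<approx> (UNIV :: nat set set)"
  proof (rule interval_continuum[where A = "\<lambda>n. torsion_alg (p n)" and \<epsilon> = "\<lambda>n. cycle_identity (p n)",
        OF assms ai_semiring_S7 _ _ _ _ _ sep])
    show "finite (carrier S7)"
    proof (rule finite_subset)
      show "carrier S7 \<subseteq> {S7_0, S7_a, S7_1}" using s7.exhaust by blast
    qed simp
  qed (simp_all add: S7_if_B21 B21_cycle_identity p2 p0 ai_semiring_torsion_alg finite_torsion_alg
      torsion_alg_satisfies del: torsion_alg_simps)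
  show "(variety_interval (generated_variety B21) (generated_variety (adjoin_zero B21))
      :: 'u alg set set) \<approx> (UNIV :: nat set set)"
  proof (rule interval_continuum[where A = "\<lambda>n. torsion_alg (p n)" and \<epsilon> = "\<lambda>n. cycle_identity (p n)",
        OF assms ai_semiring_B21 _ _ _ _ _ sep])
    show "finite (carrier B21)" by (simp add: B21_def B21_carrier_def)
  qed (simp_all add: S70_if_B210 B21_cycle_identity p2 p0 ai_semiring_torsion_alg finite_torsion_alg
      torsion_alg_satisfies del: torsion_alg_simps)
qed

end
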